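(* Let $T$ be a complete first-order theory, $\mathfrak{C}$ a monster model of $T$ and $\bar c$ an enumeration of $\mathfrak{C}$. (i) For a complete type $q\in S(\emptyset)$ in finitely many variables, the following are equivalent: (1) $q$ has the definable elementary embedding Ramsey property (DEERP); (2) there is $\eta\in\mathrm{EL}(S_{\bar c}(\mathfrak{C}))$ mapping every realized type in $S_{\bar c}(\mathfrak{C})$ into $\mathrm{Inv}_{q,\bar c}(\mathfrak{C})$; (3) $\mathrm{Inv}_{q,\bar c}(\mathfrak{C})\neq\emptyset$. (ii) The following are equivalent: (1) $T$ has DEERP; (2) there is $\eta\in\mathrm{EL}(S_{\bar c}(\mathfrak{C}))$ mapping every realized type in $S_{\bar c}(\mathfrak{C})$ into $\mathrm{Inv}_{\bar c}(\mathfrak{C})$; (3) $T$ is extremely amenable, that is $\mathrm{Inv}_{\bar c}(\mathfrak{C})\neq\emptyset$.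
   Context: A monster model is a $\kappa$-saturated, strongly $\kappa$-homogeneous model for a large cardinal $\kappa$. $S_{\bar c}(\mathfrak{C})$ is the space of complete types over $\mathfrak{C}$ extending $\mathrm{tp}(\bar c/\emptyset)$, an $\mathrm{Aut}(\mathfrak{C})$-flow; its realized types are the types $\mathrm{tp}(\bar c'/\mathfrak{C})$ of tuples $\bar c'$ of elements of $\mathfrak{C}$ with $\bar c'\equiv\bar c$. For a topological group $G$ acting continuously on a compact Hausdorff space $X$, the Ellis semigroup $\mathrm{EL}(X)$ is the closure in $X^X$ (product topology) of the maps $x\mapsto gx$, $g\in G$, under composition. $\mathrm{Inv}_{\bar c}(\mathfrak{C})$ is the set of $\mathrm{Aut}(\mathfrak{C})$-invariant types in $S_{\bar c}(\mathfrak{C})$. For a finitary $q\in S_{\bar x}(\emptyset)$, $\mathrm{Inv}_{q,\bar c}(\mathfrak{C})$ is the set of $p(\bar y)\in S_{\bar c}(\mathfrak{C})$ such that for every formula $\varphi(\bar x,\bar y)$ without parameters and all $\bar a,\bar a'\models q$: $\varphi(\bar a,\bar y)\in p$ iff $\varphi(\bar a',\bar y)\in p$. For a finite tuple $\bar a$ and $C\subseteq\mathfrak{C}$ (or a tuple, viewed as a set), $\binom{C}{\bar a}$ is the set of tuples $\bar a'$ from $C$ with $\bar a'\equiv\bar a$. A coloring $c:\binom{\mathfrak{C}}{\bar a}\to 2^n$ is definable if there are formulae with parameters $\varphi_i(\bar x)$, $i<n$, with $c(\bar a')(i)=1$ iff $\models\varphi_i(\bar a')$. A finitary type $q$ has DEERP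 if for some (equivalently any) $\bar a\models q$, every finite $\bar b\subseteq\mathfrak{C}$ containing $\bar a$, every $n$ and every definable coloring $c:\binom{\mathfrak{C}}{\bar a}\to 2^n$, there is $\bar b'\in\binom{\mathfrak{C}}{\bar b}$ with $c$ constant on $\binom{\bar b'}{\bar a}$. $T$ has DEERP if every finitary type in $S(\emptyset)$ has it. $T$ is extremely amenable if every type $p\in S(\emptyset)$ has an $\mathrm{Aut}(\mathfrak{C})$-invariant global extension. *)

theory Defs
  imports "HOL-Analysis.Analysis"
begin

unbundle cardinal_syntax

section \<open>First-order syntax and semantics\<close>

text \<open>
  Free variables are named by an arbitrary type \<^typ>\<open>'v\<close>, bound variables are de Bruijn indices.
  Hence instantiating or renaming free variables is just the map function of the datatype, and a
  formula with variables from \<open>V\<close> and parameters from \<open>A\<close> is a formula with free variables from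
  the disjoint sum \<open>V <+> A\<close>, where \<open>Inr a\<close> is always evaluated as \<open>a\<close>.
\<close>

datatype (tm_syms: 'f, tm_vars: 'v) tm =
  Var 'v | Bnd nat | App 'f "('f, 'v) tm list"
  for map: map_tm

datatype (fm_funs: 'f, fm_rels: 'r, fm_vars: 'v) fm =
    Eq "('f, 'v) tm" "('f, 'v) tm"
  | Rel 'r "('f, 'v) tm list"
  | Neg "('f, 'r, 'v) fm"
  | Conj "('f, 'r, 'v) fm" "('f, 'r, 'v) fm"
  | Ex "('f, 'r, 'v) fm"
  for map: map_fm

text \<open>The symbols of a language are those at which the arity maps are defined.\<close>

record ('f, 'r) language =
  fun_ar :: "'f \<rightharpoonup> nat"
  rel_ar :: "'r \<rightharpoonup> nat"

primrec wf_tm :: "('f, 'r) language \<Rightarrow> nat \<Rightarrow> ('f, 'v) tm \<Rightarrow> bool" where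
  "wf_tm L k (Var x) \<longleftrightarrow> True"
| "wf_tm L k (Bnd i) \<longleftrightarrow> i < k"
| "wf_tm L k (App f ts) \<longleftrightarrow> fun_ar L f = Some (length ts) \<and> list_all (wf_tm L k) ts"

primrec wf_fm :: "('f, 'r) language \<Rightarrow> nat \<Rightarrow> ('f, 'r, 'v) fm \<Rightarrow> bool" where
  "wf_fm L k (Eq s t) \<longleftrightarrow> wf_tm L k s \<and> wf_tm L k t"
| "wf_fm L k (Rel r ts) \<longleftrightarrow> rel_ar L r = Some (length ts) \<and> list_all (wf_tm L k) ts"
| "wf_fm L k (Neg \<phi>) \<longleftrightarrow> wf_fm L k \<phi>"
| "wf_fm L k (Conj \<phi> \<psi>) \<longleftrightarrow> wf_fm L k \<phi> \<and> wf_fm L k \<psi>"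
| "wf_fm L k (Ex \<phi>) \<longleftrightarrow> wf_fm L (Suc k) \<phi>"

definition fmlas :: "('f, 'r) language \<Rightarrow> 'v set \<Rightarrow> ('f, 'r, 'v) fm set" where
  "fmlas L V = {\<phi>. wf_fm L 0 \<phi> \<and> fm_vars \<phi> \<subseteq> V}"

abbreviation rename :: "('v \<Rightarrow> 'w) \<Rightarrow> ('f, 'r, 'v) fm \<Rightarrow> ('f, 'r, 'w) fm" where
  "rename h \<equiv> map_fm id id h"

record ('f, 'r, 'm) struct =
  univ :: "'m set"
  fun_int :: "'f \<Rightarrow> 'm list \<Rightarrow> 'm"
  rel_int :: "'r \<Rightarrow> 'm list \<Rightarrow> bool"

definition is_struct :: "('f, 'r) language \<Rightarrow> ('f, 'r, 'm) struct \<Rightarrow> bool" where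
  "is_struct L M \<longleftrightarrow> univ M \<noteq> {} \<and>
     (\<forall>f xs. fun_ar L f = Some (length xs) \<and> set xs \<subseteq> univ M \<longrightarrow> fun_int M f xs \<in> univ M)"

primrec tm_val :: "('f, 'r, 'm) struct \<Rightarrow> ('v \<Rightarrow> 'm) \<Rightarrow> 'm list \<Rightarrow> ('f, 'v) tm \<Rightarrow> 'm" where
  "tm_val M v e (Var x) = v x"
| "tm_val M v e (Bnd i) = e ! i"
| "tm_val M v e (App f ts) = fun_int M f (map (tm_val M v e) ts)"

primrec sat :: "('f, 'r, 'm) struct \<Rightarrow> ('v \<Rightarrow> 'm) \<Rightarrow> 'm list \<Rightarrow> ('f, 'r, 'v) fm \<Rightarrow> bool" where
  "sat M v e (Eq s t) \<longleftrightarrow> tm_val M v e s = tm_val M v e t"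
| "sat M v e (Rel r ts) \<longleftrightarrow> rel_int M r (map (tm_val M v e) ts)"
| "sat M v e (Neg \<phi>) \<longleftrightarrow> \<not> sat M v e \<phi>"
| "sat M v e (Conj \<phi> \<psi>) \<longleftrightarrow> sat M v e \<phi> \<and> sat M v e \<psi>"
| "sat M v e (Ex \<phi>) \<longleftrightarrow> (\<exists>x\<in>univ M. sat M v (x # e) \<phi>)"

abbreviation holds :: "('f, 'r, 'm) struct \<Rightarrow> ('v \<Rightarrow> 'm) \<Rightarrow> ('f, 'r, 'v) fm \<Rightarrow> bool" where
  "holds M v \<phi> \<equiv> sat M v [] \<phi>"

section \<open>Complete theories\<close>

definition sentences :: "('f, 'r) language \<Rightarrow> ('f, 'r, nat) fm set" where
  "sentences L = fmlas L {}"

definition is_model ::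
  "('f, 'r) language \<Rightarrow> ('f, 'r, nat) fm set \<Rightarrow> ('f, 'r, 'm) struct \<Rightarrow> bool" where
  "is_model L T M \<longleftrightarrow> is_struct L M \<and> (\<forall>\<phi>\<in>T. \<forall>v. holds M v \<phi>)"

text \<open>
  By the downward Loewenheim--Skolem theorem, consequence may be tested on models whose universe
  is a subset of a fixed type of cardinality at least that of the set of formulas; the type of
  formulas itself is such a type.
\<close>

definition entails ::
  "('f, 'r) language \<Rightarrow> ('f, 'r, nat) fm set \<Rightarrow> ('f, 'r, nat) fm \<Rightarrow> bool" where
  "entails L T \<phi> \<longleftrightarrow>
     (\<forall>N :: ('f, 'r, ('f, 'r, nat) fm) struct. is_model L T N \<longrightarrow> (\<forall>v. holds N v \<phi>))"

definition complete_theory ::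
  "('f, 'r) language \<Rightarrow> ('f, 'r, nat) fm set \<Rightarrow> bool" where
  "complete_theory L T \<longleftrightarrow> T \<subseteq> sentences L \<and>
     (\<exists>N :: ('f, 'r, ('f, 'r, nat) fm) struct. is_model L T N) \<and>
     (\<forall>\<phi>\<in>sentences L. entails L T \<phi> \<or> entails L T (Neg \<phi>))"

section \<open>Types and the monster model\<close>

definition tp :: "('f, 'r) language \<Rightarrow> ('f, 'r, 'm) struct \<Rightarrow> 'm set \<Rightarrow> 'v set \<Rightarrow> ('v \<Rightarrow> 'm) \<Rightarrow>
    ('f, 'r, 'v + 'm) fm set" where
  "tp L M A V v = {\<phi> \<in> fmlas L (V <+> A). holds M (case_sum v id) \<phi>}"

definition finitely_satisfiable ::
  "('f, 'r, 'm) struct \<Rightarrow> 'v set \<Rightarrow> ('f, 'r, 'v + 'm) fm set \<Rightarrow> bool" where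
  "finitely_satisfiable M V p \<longleftrightarrow>
     (\<forall>F. finite F \<and> F \<subseteq> p \<longrightarrow> (\<exists>v \<in> V \<rightarrow> univ M. \<forall>\<phi>\<in>F. holds M (case_sum v id) \<phi>))"

text \<open>
  The space of complete types over \<open>A\<close> in the variables \<open>V\<close>. Consistency with the elementary
  diagram of \<open>M\<close> is the same as finite satisfiability in \<open>M\<close>.
\<close>

definition type_space :: "('f, 'r) language \<Rightarrow> ('f, 'r, 'm) struct \<Rightarrow> 'm set \<Rightarrow> 'v set \<Rightarrow>
    ('f, 'r, 'v + 'm) fm set set" where
  "type_space L M A V = {p. p \<subseteq> fmlas L (V <+> A) \<and> finitely_satisfiable M V p \<and>
     (\<forall>\<phi> \<in> fmlas L (V <+> A). \<phi> \<in> p \<or> Neg \<phi> \<in> p)}"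

text \<open>Finite tuples are lists; an \<open>n\<close>-tuple is matched with the variables \<open>0, \<dots>, n - 1\<close>.\<close>

definition tuple_tp :: "('f, 'r) language \<Rightarrow> ('f, 'r, 'm) struct \<Rightarrow> 'm set \<Rightarrow> 'm list \<Rightarrow>
    ('f, 'r, nat + 'm) fm set" where
  "tuple_tp L M A a = tp L M A {..<length a} (\<lambda>k. a ! k)"

definition realizations :: "('f, 'r) language \<Rightarrow> ('f, 'r, 'm) struct \<Rightarrow> 'm set \<Rightarrow> nat \<Rightarrow>
    ('f, 'r, nat + 'm) fm set \<Rightarrow> 'm list set" where
  "realizations L M A n p =
     {a. length a = n \<and> set a \<subseteq> univ M \<and> tuple_tp L M A a = p}"

definition Aut :: "('f, 'r) language \<Rightarrow> ('f, 'r, 'm) struct \<Rightarrow> ('m \<Rightarrow> 'm) set" where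
  "Aut L M = {g. bij_betw g (univ M) (univ M) \<and>
     (\<forall>f xs. fun_ar L f = Some (length xs) \<and> set xs \<subseteq> univ M \<longrightarrow>
        g (fun_int M f xs) = fun_int M f (map g xs)) \<and>
     (\<forall>r xs. rel_ar L r = Some (length xs) \<and> set xs \<subseteq> univ M \<longrightarrow>
        (rel_int M r (map g xs) \<longleftrightarrow> rel_int M r xs))}"

definition elementary_map ::
  "('f, 'r) language \<Rightarrow> ('f, 'r, 'm) struct \<Rightarrow> 'm set \<Rightarrow> ('m \<Rightarrow> 'm) \<Rightarrow> bool" where
  "elementary_map L M A h \<longleftrightarrow> h ` A \<subseteq> univ M \<and>
     (\<forall>\<phi> \<in> fmlas L A. holds M id \<phi> \<longleftrightarrow> holds M h \<phi>)"

definition saturated ::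
  "'k rel \<Rightarrow> ('f, 'r) language \<Rightarrow> ('f, 'r, 'm) struct \<Rightarrow> bool" where
  "saturated \<kappa> L M \<longleftrightarrow> (\<forall>A \<subseteq> univ M. |A| <o \<kappa> \<longrightarrow>
     (\<forall>n. \<forall>p \<in> type_space L M A {..<n}. realizations L M A n p \<noteq> {}))"

definition strongly_homogeneous ::
  "'k rel \<Rightarrow> ('f, 'r) language \<Rightarrow> ('f, 'r, 'm) struct \<Rightarrow> bool" where
  "strongly_homogeneous \<kappa> L M \<longleftrightarrow> (\<forall>A \<subseteq> univ M. |A| <o \<kappa> \<longrightarrow>
     (\<forall>h. elementary_map L M A h \<longrightarrow> (\<exists>g \<in> Aut L M. \<forall>x\<in>A. g x = h x)))"

text \<open>``Large'' means larger than the number of formulas (so in particular uncountable).\<close>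

definition monster_model :: "'k rel \<Rightarrow> ('f, 'r) language \<Rightarrow> ('f, 'r, nat) fm set \<Rightarrow>
    ('f, 'r, 'm) struct \<Rightarrow> bool" where
  "monster_model \<kappa> L T M \<longleftrightarrow> Card_order \<kappa> \<and>
     |fmlas L (UNIV :: nat set) :: ('f, 'r, nat) fm set| <o \<kappa> \<and>
     is_model L T M \<and> saturated \<kappa> L M \<and> strongly_homogeneous \<kappa> L M"

section \<open>The flow \<open>S\<^sub>c\<close> and its Ellis semigroup\<close>

text \<open>A possibly infinite tuple is a function \<open>c\<close> on an index type \<^typ>\<open>'i\<close>.\<close>

definition S_ext :: "('f, 'r) language \<Rightarrow> ('f, 'r, 'm) struct \<Rightarrow> ('i \<Rightarrow> 'm) \<Rightarrow>
    ('f, 'r, 'i + 'm) fm set set" where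
  "S_ext L M c = {p \<in> type_space L M (univ M) UNIV. tp L M {} UNIV c \<subseteq> p}"

definition S_ext_topology :: "('f, 'r) language \<Rightarrow> ('f, 'r, 'm) struct \<Rightarrow> ('i \<Rightarrow> 'm) \<Rightarrow>
    ('f, 'r, 'i + 'm) fm set topology" where
  "S_ext_topology L M c = topology_generated_by
     {{p \<in> S_ext L M c. \<phi> \<in> p} | \<phi>. \<phi> \<in> fmlas L (UNIV <+> univ M)}"

definition realized_types :: "('f, 'r) language \<Rightarrow> ('f, 'r, 'm) struct \<Rightarrow> ('i \<Rightarrow> 'm) \<Rightarrow>
    ('f, 'r, 'i + 'm) fm set set" where
  "realized_types L M c = {tp L M (univ M) UNIV c' | c'.
     range c' \<subseteq> univ M \<and> tp L M {} UNIV c' = tp L M {} UNIV c}"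

definition act :: "('m \<Rightarrow> 'm) \<Rightarrow> ('f, 'r, 'v + 'm) fm set \<Rightarrow> ('f, 'r, 'v + 'm) fm set" where
  "act g p = rename (map_sum id g) ` p"

definition ellis_semigroup :: "'x topology \<Rightarrow> 'g set \<Rightarrow> ('g \<Rightarrow> 'x \<Rightarrow> 'x) \<Rightarrow> ('x \<Rightarrow> 'x) set" where
  "ellis_semigroup X G \<alpha> = product_topology (\<lambda>_. X) (topspace X) closure_of
     ((\<lambda>g. restrict (\<alpha> g) (topspace X)) ` G)"

definition EL :: "('f, 'r) language \<Rightarrow> ('f, 'r, 'm) struct \<Rightarrow> ('i \<Rightarrow> 'm) \<Rightarrow>
    (('f, 'r, 'i + 'm) fm set \<Rightarrow> ('f, 'r, 'i + 'm) fm set) set" where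
  "EL L M c = ellis_semigroup (S_ext_topology L M c) (Aut L M) act"

definition Inv :: "('f, 'r) language \<Rightarrow> ('f, 'r, 'm) struct \<Rightarrow> ('i \<Rightarrow> 'm) \<Rightarrow>
    ('f, 'r, 'i + 'm) fm set set" where
  "Inv L M c = {p \<in> S_ext L M c. \<forall>g \<in> Aut L M. act g p = p}"

text \<open>From \<open>\<phi>(x, y)\<close> to \<open>\<phi>(a, y)\<close>.\<close>

definition plug :: "'m list \<Rightarrow> ('f, 'r, nat + 'i) fm \<Rightarrow> ('f, 'r, 'i + 'm) fm" where
  "plug a = rename (case_sum (\<lambda>k. Inr (a ! k)) Inl)"

definition Inv_q :: "('f, 'r) language \<Rightarrow> ('f, 'r, 'm) struct \<Rightarrow> nat \<Rightarrow>
    ('f, 'r, nat + 'm) fm set \<Rightarrow> ('i \<Rightarrow> 'm) \<Rightarrow> ('f, 'r, 'i + 'm) fm set set" where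
  "Inv_q L M n q c = {p \<in> S_ext L M c.
     \<forall>\<phi> \<in> fmlas L ({..<n} <+> (UNIV :: 'i set)).
       \<forall>a \<in> realizations L M {} n q. \<forall>a' \<in> realizations L M {} n q.
         plug a \<phi> \<in> p \<longleftrightarrow> plug a' \<phi> \<in> p}"

section \<open>DEERP and extreme amenability\<close>

definition copies :: "('f, 'r) language \<Rightarrow> ('f, 'r, 'm) struct \<Rightarrow> 'm set \<Rightarrow> 'm list \<Rightarrow>
    'm list set" where
  "copies L M C a =
     {a'. set a' \<subseteq> C \<and> length a' = length a \<and> tuple_tp L M {} a' = tuple_tp L M {} a}"

text \<open>
  Colors are elements of \<open>2\<^sup>n\<close>, i.e. (extensional) functions from \<open>{..<n}\<close> to \<open>{0, 1}\<close>.
\<close>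

definition definable_coloring :: "('f, 'r) language \<Rightarrow> ('f, 'r, 'm) struct \<Rightarrow> 'm list \<Rightarrow> nat \<Rightarrow>
    ('m list \<Rightarrow> nat \<Rightarrow> nat) \<Rightarrow> bool" where
  "definable_coloring L M a n col \<longleftrightarrow>
     col \<in> copies L M (univ M) a \<rightarrow> ({..<n} \<rightarrow>\<^sub>E {0, 1}) \<and>
     (\<exists>\<phi> :: nat \<Rightarrow> ('f, 'r, nat + 'm) fm.
        (\<forall>i<n. \<phi> i \<in> fmlas L ({..<length a} <+> univ M)) \<and>
        (\<forall>a' \<in> copies L M (univ M) a. \<forall>i<n.
           col a' i = 1 \<longleftrightarrow> holds M (case_sum (\<lambda>k. a' ! k) id) (\<phi> i)))"

definition type_DEERP :: "('f, 'r) language \<Rightarrow> ('f, 'r, 'm) struct \<Rightarrow> nat \<Rightarrow>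
    ('f, 'r, nat + 'm) fm set \<Rightarrow> bool" where
  "type_DEERP L M n q \<longleftrightarrow> (\<exists>a \<in> realizations L M {} n q.
     \<forall>b. set b \<subseteq> univ M \<and> set a \<subseteq> set b \<longrightarrow>
       (\<forall>k col. definable_coloring L M a k col \<longrightarrow>
          (\<exists>b' \<in> copies L M (univ M) b. col constant_on copies L M (set b') a)))"

text \<open>
  Properties of a complete theory are expressed through its monster model \<open>M\<close>; the types over the
  empty set are those in \<open>type_space L M {}\<close>.
\<close>

definition theory_DEERP :: "('f, 'r) language \<Rightarrow> ('f, 'r, 'm) struct \<Rightarrow> bool" where
  "theory_DEERP L M \<longleftrightarrow> (\<forall>n. \<forall>q \<in> type_space L M {} {..<n}. type_DEERP L M n q)"

text \<open>
  The variables of the types over the empty set range over arbitrary (finite or infinite) sets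
  \<open>V\<close> of variables from the type \<^typ>\<open>'v\<close>, which is meant to be infinite.
\<close>

definition extremely_amenable ::
  "'v itself \<Rightarrow> ('f, 'r) language \<Rightarrow> ('f, 'r, 'm) struct \<Rightarrow> bool" where
  "extremely_amenable _ L M \<longleftrightarrow> (\<forall>V :: 'v set. \<forall>p \<in> type_space L M {} V.
     \<exists>r \<in> type_space L M (univ M) V. p \<subseteq> r \<and> (\<forall>g \<in> Aut L M. act g r = r))"

end

theory Submission
  imports Defs
begin

text \<open>
  Everything reduces to one density statement: by saturation and homogeneity for finite sets, any
  finite part of a type in \<open>S\<^sub>c\<close> is realized by \<open>\<sigma>(c)\<close> for an automorphism \<open>\<sigma>\<close>. A definable coloring
  given by \<open>\<phi>\<^sub>i(x, c)\<close> is constant on the copies of \<open>a\<close> in \<open>\<sigma>\<^sup>-\<^sup>1(b)\<close> iff \<open>\<sigma>(c)\<close> satisfies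
  \<open>\<phi>\<^sub>i(a', y) \<leftrightarrow> \<phi>\<^sub>i(a'', y)\<close> for all copies \<open>a'\<close>, \<open>a''\<close> in \<open>b\<close>; by compactness DEERP for \<open>q\<close> is therefore
  the existence of a \<open>q\<close>-invariant type. Given such a type \<open>p\<close>, compactness of the space of maps on \<open>S\<^sub>c\<close>
  yields a limit \<open>\<eta>\<close> of automorphisms with \<open>\<eta>(tp(c)) = p\<close>, and every other realized type is a
  reindexing of \<open>tp(c)\<close>.
\<close>

section \<open>Renaming, automorphisms and satisfaction\<close>

text \<open>The enumeration \<open>c\<close> is as long as the model, in general beyond the reach of
  homogeneity, and a type in \<open>S_ext\<close> need not be the type of any
  \<open>g \<circ> c\<close>. Automorphisms can be steered on finitely many coordinates only, and
  what they achieve there has to be glued by compactness. This dictates the form in which invariance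
  is handled: as a family of biconditionals between formulas, each a clopen condition on types and
  on maps of types, so that it survives the passage to limits. That \<open>c\<close> exhausts the
  model is what ties colorings to types. A parameter of a coloring formula is an entry of
  \<open>c\<close> and can be traded for the variable of that coordinate; the result is a
  parameter-free formula in x and y, just the kind that \<open>Inv_q\<close> tests.\<close>

lemma tm_val_cong:
  assumes "\<And>x. x \<in> tm_vars t \<Longrightarrow> v x = w x"
  shows "tm_val M v e t = tm_val M w e t"
  using assms
proof (induction t)
  case (App f ts)
  then have "map (tm_val M v e) ts = map (tm_val M w e) ts" by fastforce
  then show ?case by (metis tm_val.simps(3))
qed simp_all

lemma sat_cong:
  assumes "\<And>x. x \<in> fm_vars \<phi> \<Longrightarrow> v x = w x"
  shows "sat M v e \<phi> \<longleftrightarrow> sat M w e \<phi>"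
  using assms
proof (induction \<phi> arbitrary: e)
  case (Eq s t)
  then show ?case using tm_val_cong[of s v w M e] tm_val_cong[of t v w M e] by simp
next
  case (Rel r ts)
  then have "map (tm_val M v e) ts = map (tm_val M w e) ts"
    by (auto intro!: tm_val_cong)
  then show ?case by (metis sat.simps(2))
qed simp_all

lemma tm_val_rename: "tm_val M v e (map_tm id h t) = tm_val M (v \<circ> h) e t"
  by (induction t) (auto intro!: arg_cong[where f = "fun_int M _"])

lemma sat_rename: "sat M v e (rename h \<phi>) \<longleftrightarrow> sat M (v \<circ> h) e \<phi>"
proof (induction \<phi> arbitrary: e)
  case (Rel r ts)
  have "map (tm_val M v e) (map (map_tm id h) ts) = map (tm_val M (v \<circ> h) e) ts"
    by (simp add: tm_val_rename)
  then show ?case by (metis fm.map(2) id_apply sat.simps(2))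
qed (simp_all add: tm_val_rename)

lemma wf_tm_rename: "wf_tm L k (map_tm id h t) \<longleftrightarrow> wf_tm L k t"
  by (induction t) (auto simp: list_all_iff)

lemma wf_fm_rename: "wf_fm L k (rename h \<phi>) \<longleftrightarrow> wf_fm L k \<phi>"
  by (induction \<phi> arbitrary: k) (auto simp: wf_tm_rename list_all_iff)

lemma rename_rename: "rename h (rename k \<phi>) = rename (h \<circ> k) \<phi>"
  by (simp add: fm.map_comp)

lemma rename_cong: "(\<And>x. x \<in> fm_vars \<phi> \<Longrightarrow> h x = k x) \<Longrightarrow> rename h \<phi> = rename k \<phi>"
  by (rule fm.map_cong) auto

lemma rename_idem: "(\<And>x. x \<in> fm_vars \<phi> \<Longrightarrow> h x = x) \<Longrightarrow> rename h \<phi> = \<phi>"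
  using rename_cong[of \<phi> h id] by (simp add: fm.map_id)

lemma fmlas_rename:
  "\<phi> \<in> fmlas L V \<Longrightarrow> (\<And>x. x \<in> V \<Longrightarrow> h x \<in> W) \<Longrightarrow> rename h \<phi> \<in> fmlas L W"
  unfolding fmlas_def wf_fm_rename fm.set_map mem_Collect_eq by blast

lemma fmlas_Neg [simp]: "Neg \<phi> \<in> fmlas L V \<longleftrightarrow> \<phi> \<in> fmlas L V"
  by (simp add: fmlas_def)

lemma fmlas_mono: "\<phi> \<in> fmlas L V \<Longrightarrow> V \<subseteq> W \<Longrightarrow> \<phi> \<in> fmlas L W"
  by (auto simp: fmlas_def)

lemma fmlas_restrict: "\<phi> \<in> fmlas L V \<Longrightarrow> fm_vars \<phi> \<subseteq> W \<Longrightarrow> \<phi> \<in> fmlas L W"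
  by (auto simp: fmlas_def)

lemma fmlas_vars: "\<phi> \<in> fmlas L V \<Longrightarrow> x \<in> fm_vars \<phi> \<Longrightarrow> x \<in> V"
  by (auto simp: fmlas_def)

lemma finite_tm_vars: "finite (tm_vars t)"
  by (induction t) auto

lemma finite_fm_vars: "finite (fm_vars \<phi>)"
  by (induction \<phi>) (auto simp: finite_tm_vars)

text \<open>Turns the demand that a type decide two formulas alike into membership of one formula,
  so that compactness can impose it.\<close>

definition Iff :: "('f, 'r, 'v) fm \<Rightarrow> ('f, 'r, 'v) fm \<Rightarrow> ('f, 'r, 'v) fm" where
  "Iff \<phi> \<psi> = Conj (Neg (Conj \<phi> (Neg \<psi>))) (Neg (Conj \<psi> (Neg \<phi>)))"

lemma sat_Iff [simp]: "sat M v e (Iff \<phi> \<psi>) \<longleftrightarrow> (sat M v e \<phi> \<longleftrightarrow> sat M v e \<psi>)"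
  by (auto simp: Iff_def)

lemma fmlas_Iff [simp]: "Iff \<phi> \<psi> \<in> fmlas L V \<longleftrightarrow> \<phi> \<in> fmlas L V \<and> \<psi> \<in> fmlas L V"
  by (auto simp: Iff_def fmlas_def)

section \<open>Satisfaction under automorphisms\<close>

lemma tm_val_in_univ:
  assumes "is_struct L M" "wf_tm L (length e) t" "set e \<subseteq> univ M" "v ` tm_vars t \<subseteq> univ M"
  shows "tm_val M v e t \<in> univ M"
  using assms
proof (induction t)
  case (App f ts)
  have "wf_tm L (length e) t" "v ` tm_vars t \<subseteq> univ M" if "t \<in> set ts" for t
    using App.prems that by (auto simp: list_all_iff)
  then have "set (map (tm_val M v e) ts) \<subseteq> univ M"
    using App.IH App.prems by auto
  moreover have "fun_ar L f = Some (length (map (tm_val M v e) ts))"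
    using App.prems by simp
  ultimately show ?case
    using App.prems(1) unfolding is_struct_def by (metis tm_val.simps(3))
qed auto

lemma tm_val_Aut:
  assumes "is_struct L M" "g \<in> Aut L M"
    and "wf_tm L (length e) t" "set e \<subseteq> univ M" "v ` tm_vars t \<subseteq> univ M"
  shows "tm_val M (g \<circ> v) (map g e) t = g (tm_val M v e t)"
  using assms
proof (induction t)
  case (App f ts)
  have ts: "wf_tm L (length e) t" "v ` tm_vars t \<subseteq> univ M" if "t \<in> set ts" for t
    using App.prems that by (auto simp: list_all_iff)
  then have "set (map (tm_val M v e) ts) \<subseteq> univ M"
    using App.prems by (auto intro!: tm_val_in_univ)
  moreover have "fun_ar L f = Some (length (map (tm_val M v e) ts))"
    using App.prems by simp
  ultimately have "g (fun_int M f (map (tm_val M v e) ts))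
      = fun_int M f (map g (map (tm_val M v e) ts))"
    using App.prems(2) unfolding Aut_def by blast
  moreover have "map g (map (tm_val M v e) ts) = map (tm_val M (g \<circ> v) (map g e)) ts"
    unfolding map_map
  proof (rule map_cong)
    fix t assume "t \<in> set ts"
    then show "(g \<circ> tm_val M v e) t = tm_val M (g \<circ> v) (map g e) t"
      using App.IH[of t] App.prems ts by (metis o_apply)
  qed simp
  ultimately show ?case by (metis tm_val.simps(3))
qed auto

text \<open>Each property of an automorphism pays for one case: injectivity for equations,
  preservation of relations for atoms, surjectivity for the quantifier. The stack \<open>e\<close>
  holds the values of the bound variables and is moved along with \<open>v\<close>. All values must
  lie in the universe, as \<open>Aut\<close> says nothing about \<open>g\<close> elsewhere.\<close>

lemma sat_Aut:
  assumes "is_struct L M" "g \<in> Aut L M"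
    and "wf_fm L (length e) \<phi>" "set e \<subseteq> univ M" "v ` fm_vars \<phi> \<subseteq> univ M"
  shows "sat M (g \<circ> v) (map g e) \<phi> \<longleftrightarrow> sat M v e \<phi>"
  using assms(3-)
proof (induction \<phi> arbitrary: e)
  case (Eq s t)
  have "inj_on g (univ M)"
    using assms(2) by (auto simp: Aut_def bij_betw_def)
  moreover have "tm_val M v e s \<in> univ M" "tm_val M v e t \<in> univ M"
    "tm_val M (g \<circ> v) (map g e) s = g (tm_val M v e s)"
    "tm_val M (g \<circ> v) (map g e) t = g (tm_val M v e t)"
    using Eq assms(1,2) by (auto intro!: tm_val_in_univ tm_val_Aut simp del: o_apply)
  ultimately show ?case by (metis inj_onD sat.simps(1))
next
  case (Rel r ts)
  have ts: "wf_tm L (length e) t" "v ` tm_vars t \<subseteq> univ M" if "t \<in> set ts" for t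
    using Rel.prems that by (auto simp: list_all_iff)
  then have "set (map (tm_val M v e) ts) \<subseteq> univ M"
    using Rel.prems assms(1) by (auto intro!: tm_val_in_univ)
  moreover have "rel_ar L r = Some (length (map (tm_val M v e) ts))"
    using Rel.prems by simp
  ultimately have "rel_int M r (map g (map (tm_val M v e) ts))
      \<longleftrightarrow> rel_int M r (map (tm_val M v e) ts)"
    using assms(2) unfolding Aut_def by blast
  moreover have "map g (map (tm_val M v e) ts) = map (tm_val M (g \<circ> v) (map g e)) ts"
    using Rel.prems assms(1,2) ts tm_val_Aut by fastforce
  ultimately show ?case by (metis sat.simps(2))
next
  case (Ex \<phi>)
  have im: "g ` univ M = univ M"
    using assms(2) by (auto simp: Aut_def bij_betw_def)
  have "sat M (g \<circ> v) (map g (x # e)) \<phi> \<longleftrightarrow> sat M v (x # e) \<phi>" if "x \<in> univ M" for x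
    using Ex.prems that by (intro Ex.IH) auto
  then have "(\<exists>x\<in>univ M. sat M v (x # e) \<phi>) \<longleftrightarrow> (\<exists>y\<in>g ` univ M. sat M (g \<circ> v) (y # map g e) \<phi>)"
    by auto
  then show ?case by (simp add: im comp_def)
qed (simp_all add: image_Un)

lemma holds_Aut:
  assumes "is_struct L M" "g \<in> Aut L M" "\<phi> \<in> fmlas L V" "v ` V \<subseteq> univ M"
  shows "holds M (g \<circ> v) \<phi> \<longleftrightarrow> holds M v \<phi>"
proof -
  have "v ` fm_vars \<phi> \<subseteq> univ M"
    using assms(3,4) unfolding fmlas_def by blast
  then show ?thesis
    using sat_Aut[OF assms(1,2), of "[]" \<phi> v] assms(3) by (simp add: fmlas_def)
qed

lemma Aut_in_univ: "g \<in> Aut L M \<Longrightarrow> x \<in> univ M \<Longrightarrow> g x \<in> univ M"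
  by (auto simp: Aut_def bij_betw_def)

text \<open>Members of \<open>Aut\<close> are arbitrary outside the universe, so the inverse is an
  \<open>inv_into\<close>, and cancellation is claimed on the universe only.\<close>

lemma Aut_inverse:
  assumes "is_struct L M" "g \<in> Aut L M"
  obtains h where "h \<in> Aut L M" "\<And>x. x \<in> univ M \<Longrightarrow> g (h x) = x" "\<And>x. x \<in> univ M \<Longrightarrow> h (g x) = x"
proof -
  define h where "h = inv_into (univ M) g"
  have bij: "bij_betw g (univ M) (univ M)"
    using assms(2) by (simp add: Aut_def)
  have hbij: "bij_betw h (univ M) (univ M)"
    using bij by (simp add: h_def bij_betw_inv_into)
  have gh: "g (h x) = x" if "x \<in> univ M" for x
    using bij that by (simp add: h_def bij_betw_inv_into_right)
  have hg: "h (g x) = x" if "x \<in> univ M" for x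
    using bij that by (simp add: h_def bij_betw_inv_into_left)
  have hin: "set (map h xs) \<subseteq> univ M" if "set xs \<subseteq> univ M" for xs
    using that bij_betw_imp_surj_on[OF hbij] by auto
  have ghs: "map g (map h xs) = xs" if "set xs \<subseteq> univ M" for xs
    using that gh by (auto simp: map_idI subset_iff)
  have "h (fun_int M f xs) = fun_int M f (map h xs)"
    if "fun_ar L f = Some (length xs)" "set xs \<subseteq> univ M" for f xs
  proof -
    have "g (fun_int M f (map h xs)) = fun_int M f (map g (map h xs))"
      using assms(2) that hin[OF that(2)] unfolding Aut_def by (simp del: map_map)
    then have "g (fun_int M f (map h xs)) = fun_int M f xs"
      by (simp only: ghs[OF that(2)])
    moreover have "fun_int M f (map h xs) \<in> univ M"
      using assms(1) that hin[OF that(2)] by (simp add: is_struct_def)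
    ultimately show ?thesis using hg by metis
  qed
  moreover have "rel_int M r (map h xs) \<longleftrightarrow> rel_int M r xs"
    if "rel_ar L r = Some (length xs)" "set xs \<subseteq> univ M" for r xs
  proof -
    have "rel_int M r (map g (map h xs)) \<longleftrightarrow> rel_int M r (map h xs)"
      using assms(2) that hin[OF that(2)] unfolding Aut_def by (simp del: map_map)
    then show ?thesis by (simp only: ghs[OF that(2)])
  qed
  ultimately have "h \<in> Aut L M"
    using hbij by (simp add: Aut_def)
  then show ?thesis using that gh hg by blast
qed

section \<open>Complete types\<close>

lemma type_space_fmlas: "p \<in> type_space L M A V \<Longrightarrow> \<phi> \<in> p \<Longrightarrow> \<phi> \<in> fmlas L (V <+> A)"
  by (auto simp: type_space_def)

lemma type_space_satisfiable:
  assumes "p \<in> type_space L M A V" "finite F" "F \<subseteq> p"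
  obtains v where "v \<in> V \<rightarrow> univ M" "\<forall>\<phi>\<in>F. holds M (case_sum v id) \<phi>"
  using assms by (auto simp: type_space_def finitely_satisfiable_def)

text \<open>On finitely many formulas a complete type looks like the type of an actual assignment.
  The negations put into \<open>F\<close> make that assignment also refute the members of
  \<open>D\<close> that \<open>p\<close> omits.\<close>

lemma type_space_approx:
  assumes "p \<in> type_space L M A V" "finite D" "D \<subseteq> fmlas L (V <+> A)"
  obtains v where "v \<in> V \<rightarrow> univ M" "\<And>\<phi>. \<phi> \<in> D \<Longrightarrow> \<phi> \<in> p \<longleftrightarrow> holds M (case_sum v id) \<phi>"
proof -
  define F where "F = (D \<union> Neg ` D) \<inter> p"
  have "finite F" "F \<subseteq> p" using assms(2) by (auto simp: F_def)
  then obtain v where v: "v \<in> V \<rightarrow> univ M" "\<forall>\<phi>\<in>F. holds M (case_sum v id) \<phi>"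
    using type_space_satisfiable[OF assms(1)] by metis
  have "\<phi> \<in> p \<longleftrightarrow> holds M (case_sum v id) \<phi>" if "\<phi> \<in> D" for \<phi>
  proof (cases "\<phi> \<in> p")
    case True
    then show ?thesis using v(2) that by (simp add: F_def)
  next
    case False
    then have "Neg \<phi> \<in> F" using assms(1,3) that by (auto simp: type_space_def F_def)
    then show ?thesis using v(2) False by fastforce
  qed
  then show ?thesis using v(1) that by blast
qed

lemma type_space_Neg:
  assumes "p \<in> type_space L M A V" "\<phi> \<in> fmlas L (V <+> A)"
  shows "Neg \<phi> \<in> p \<longleftrightarrow> \<phi> \<notin> p"
proof -
  obtain v where "\<And>\<psi>. \<psi> \<in> {\<phi>, Neg \<phi>} \<Longrightarrow> \<psi> \<in> p \<longleftrightarrow> holds M (case_sum v id) \<psi>"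
    by (rule type_space_approx[OF assms(1), of "{\<phi>, Neg \<phi>}"]) (use assms(2) in auto)
  from this[of \<phi>] this[of "Neg \<phi>"] show ?thesis by simp
qed

lemma type_space_Iff:
  assumes "p \<in> type_space L M A V" "Iff \<phi> \<psi> \<in> p"
  shows "\<phi> \<in> p \<longleftrightarrow> \<psi> \<in> p"
proof -
  have D: "{\<phi>, \<psi>, Iff \<phi> \<psi>} \<subseteq> fmlas L (V <+> A)"
    using type_space_fmlas[OF assms] by simp
  obtain v where "\<And>\<theta>. \<theta> \<in> {\<phi>, \<psi>, Iff \<phi> \<psi>} \<Longrightarrow> \<theta> \<in> p \<longleftrightarrow> holds M (case_sum v id) \<theta>"
    by (rule type_space_approx[OF assms(1) _ D]) auto
  from this[of \<phi>] this[of \<psi>] this[of "Iff \<phi> \<psi>"] assms(2) show ?thesis by simp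
qed

lemma type_space_subset_eq:
  assumes "p \<in> type_space L M A V" "r \<in> type_space L M A V" "p \<subseteq> r"
  shows "p = r"
proof -
  have "\<phi> \<in> p" if "\<phi> \<in> r" for \<phi>
    using type_space_Neg[OF assms(1), of \<phi>] type_space_Neg[OF assms(2), of \<phi>]
      type_space_fmlas[OF assms(2) that] assms(3) that by auto
  then show ?thesis using assms(3) by auto
qed

lemma tp_in_type_space:
  assumes "v ` V \<subseteq> univ M"
  shows "tp L M A V v \<in> type_space L M A V"
proof -
  have "finitely_satisfiable M V (tp L M A V v)"
    unfolding finitely_satisfiable_def using assms
    by (auto simp: tp_def intro!: bexI[of _ v])
  then show ?thesis by (auto simp: type_space_def tp_def)
qed

text \<open>Zorn's lemma yields a maximal finitely satisfiable set. Chains cause no trouble because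
  a finite subset of their union already lies in one member.\<close>

lemma Lindenbaum:
  assumes "\<Gamma> \<subseteq> fmlas L (V <+> A)" "finitely_satisfiable M V \<Gamma>"
  obtains p where "p \<in> type_space L M A V" "\<Gamma> \<subseteq> p"
proof -
  define \<A> where "\<A> = {p. \<Gamma> \<subseteq> p \<and> p \<subseteq> fmlas L (V <+> A) \<and> finitely_satisfiable M V p}"
  have "\<Gamma> \<in> \<A>" using assms by (simp add: \<A>_def)
  moreover have "\<Union>\<C> \<in> \<A>" if chain: "\<C> \<noteq> {}" "subset.chain \<A> \<C>" for \<C>
  proof -
    have C: "\<C> \<subseteq> \<A>" using that(2) by (simp add: subset.chain_def)
    have "finitely_satisfiable M V (\<Union>\<C>)"
      unfolding finitely_satisfiable_def
    proof (intro allI impI)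
      fix F assume F: "finite F \<and> F \<subseteq> \<Union>\<C>"
      then obtain p where "p \<in> \<C>" "F \<subseteq> p"
        using finite_subset_Union_chain[OF _ _ chain] by metis
      then show "\<exists>v\<in>V \<rightarrow> univ M. \<forall>\<phi>\<in>F. holds M (case_sum v id) \<phi>"
        using C F unfolding \<A>_def finitely_satisfiable_def by blast
    qed
    then show ?thesis using C that(1) unfolding \<A>_def by blast
  qed
  ultimately obtain p where p: "p \<in> \<A>" and max: "\<And>r. r \<in> \<A> \<Longrightarrow> p \<subseteq> r \<Longrightarrow> r = p"
    using subset_Zorn_nonempty[of \<A>] by blast
  \<comment> \<open>Maximality in use: a formula left out conflicts with a finite part of
    \<open>p\<close>. If a formula and its negation were both left out, the union of the two finite
    parts would be unsatisfiable.\<close>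
  have unsat: "\<exists>F. finite F \<and> F \<subseteq> p \<and>
      (\<forall>v\<in>V \<rightarrow> univ M. (\<forall>\<psi>\<in>F. holds M (case_sum v id) \<psi>) \<longrightarrow> \<not> holds M (case_sum v id) \<phi>)"
    if "\<phi> \<in> fmlas L (V <+> A)" "\<phi> \<notin> p" for \<phi>
  proof -
    have "insert \<phi> p \<notin> \<A>" using max[of "insert \<phi> p"] that(2) by blast
    then have "\<not> finitely_satisfiable M V (insert \<phi> p)"
      using p that(1) unfolding \<A>_def by blast
    then obtain F where F: "finite F" "F \<subseteq> insert \<phi> p"
      "\<not> (\<exists>v\<in>V \<rightarrow> univ M. \<forall>\<psi>\<in>F. holds M (case_sum v id) \<psi>)"
      unfolding finitely_satisfiable_def by blast
    then show ?thesis by (intro exI[of _ "F - {\<phi>}"]) blast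
  qed
  have "\<phi> \<in> p \<or> Neg \<phi> \<in> p" if \<phi>: "\<phi> \<in> fmlas L (V <+> A)" for \<phi>
  proof (rule ccontr)
    assume "\<not> (\<phi> \<in> p \<or> Neg \<phi> \<in> p)"
    then obtain F G where F: "finite F" "F \<subseteq> p"
      "\<forall>v\<in>V \<rightarrow> univ M. (\<forall>\<psi>\<in>F. holds M (case_sum v id) \<psi>) \<longrightarrow> \<not> holds M (case_sum v id) \<phi>"
      and G: "finite G" "G \<subseteq> p"
      "\<forall>v\<in>V \<rightarrow> univ M. (\<forall>\<psi>\<in>G. holds M (case_sum v id) \<psi>) \<longrightarrow> \<not> holds M (case_sum v id) (Neg \<phi>)"
      using unsat[of \<phi>] unsat[of "Neg \<phi>"] \<phi> by (metis fmlas_Neg)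
    have "finite (F \<union> G)" "F \<union> G \<subseteq> p" using F G by auto
    then obtain v where "v \<in> V \<rightarrow> univ M" "\<forall>\<psi>\<in>F \<union> G. holds M (case_sum v id) \<psi>"
      using p unfolding \<A>_def finitely_satisfiable_def by blast
    then show False using F(3) G(3) by (metis UnI1 UnI2 sat.simps(3))
  qed
  then have "p \<in> type_space L M A V" using p by (auto simp: \<A>_def type_space_def)
  then show ?thesis using that p by (auto simp: \<A>_def)
qed

text \<open>The form of compactness from which the invariant types are obtained:
  \<open>\<Gamma>\<close> holds the formulas prescribed outright, \<open>E\<close> the pairs to be
  decided alike. Encoding the pairs by \<open>Iff\<close> lets one appeal to
  \<open>Lindenbaum\<close> provide both.\<close>

lemma type_space_extend:
  assumes \<Gamma>: "\<Gamma> \<subseteq> fmlas L (V <+> A)"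
    and E: "\<And>\<phi> \<psi>. (\<phi>, \<psi>) \<in> E \<Longrightarrow> \<phi> \<in> fmlas L (V <+> A) \<and> \<psi> \<in> fmlas L (V <+> A)"
    and approx: "\<And>\<Gamma>\<^sub>0 E\<^sub>0. finite \<Gamma>\<^sub>0 \<Longrightarrow> \<Gamma>\<^sub>0 \<subseteq> \<Gamma> \<Longrightarrow> finite E\<^sub>0 \<Longrightarrow> E\<^sub>0 \<subseteq> E \<Longrightarrow>
      \<exists>v \<in> V \<rightarrow> univ M. (\<forall>\<phi>\<in>\<Gamma>\<^sub>0. holds M (case_sum v id) \<phi>) \<and>
        (\<forall>(\<phi>, \<psi>)\<in>E\<^sub>0. holds M (case_sum v id) \<phi> \<longleftrightarrow> holds M (case_sum v id) \<psi>)"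
  shows "\<exists>p \<in> type_space L M A V. \<Gamma> \<subseteq> p \<and> (\<forall>(\<phi>, \<psi>)\<in>E. \<phi> \<in> p \<longleftrightarrow> \<psi> \<in> p)"
proof -
  have "finitely_satisfiable M V (\<Gamma> \<union> (\<lambda>(\<phi>, \<psi>). Iff \<phi> \<psi>) ` E)"
    unfolding finitely_satisfiable_def
  proof (intro allI impI)
    fix F assume F: "finite F \<and> F \<subseteq> \<Gamma> \<union> (\<lambda>(\<phi>, \<psi>). Iff \<phi> \<psi>) ` E"
    then obtain E\<^sub>0 where E0: "E\<^sub>0 \<subseteq> E" "finite E\<^sub>0" "F - \<Gamma> = (\<lambda>(\<phi>, \<psi>). Iff \<phi> \<psi>) ` E\<^sub>0"
      using finite_subset_image[of "F - \<Gamma>" "\<lambda>(\<phi>, \<psi>). Iff \<phi> \<psi>" E] by blast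
    obtain v where v: "v \<in> V \<rightarrow> univ M" "\<forall>\<phi>\<in>F \<inter> \<Gamma>. holds M (case_sum v id) \<phi>"
      "\<forall>(\<phi>, \<psi>)\<in>E\<^sub>0. holds M (case_sum v id) \<phi> \<longleftrightarrow> holds M (case_sum v id) \<psi>"
      using approx[of "F \<inter> \<Gamma>" E\<^sub>0] F E0 by auto
    have "\<forall>\<phi>\<in>F - \<Gamma>. holds M (case_sum v id) \<phi>"
      unfolding E0(3) using v(3) by auto
    then show "\<exists>v\<in>V \<rightarrow> univ M. \<forall>\<phi>\<in>F. holds M (case_sum v id) \<phi>"
      using v(1,2) by blast
  qed
  moreover have "\<Gamma> \<union> (\<lambda>(\<phi>, \<psi>). Iff \<phi> \<psi>) ` E \<subseteq> fmlas L (V <+> A)"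
    using \<Gamma> E by auto
  ultimately obtain p where p: "p \<in> type_space L M A V" "\<Gamma> \<union> (\<lambda>(\<phi>, \<psi>). Iff \<phi> \<psi>) ` E \<subseteq> p"
    using Lindenbaum by blast
  have "\<phi> \<in> p \<longleftrightarrow> \<psi> \<in> p" if "(\<phi>, \<psi>) \<in> E" for \<phi> \<psi>
    using p that by (intro type_space_Iff[OF p(1)]) auto
  then show ?thesis using p by auto
qed

section \<open>Instances of formulas and types of finite tuples\<close>

lemma holds_plug: "holds M (case_sum w id) (plug a \<phi>) \<longleftrightarrow> holds M (case_sum (\<lambda>k. a ! k) w) \<phi>"
proof -
  have "case_sum w id \<circ> case_sum (\<lambda>k. Inr (a ! k)) Inl = case_sum (\<lambda>k. a ! k) w"
    by (auto simp: fun_eq_iff split: sum.split)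
  then show ?thesis by (simp only: plug_def sat_rename)
qed

lemma holds_rename_map_sum:
  "holds M (case_sum v w) (rename (map_sum s t) \<phi>) \<longleftrightarrow> holds M (case_sum (v \<circ> s) (w \<circ> t)) \<phi>"
  by (simp only: sat_rename case_sum_o_map_sum)

lemma plug_in_fmlas:
  "\<phi> \<in> fmlas L ({..<length a} <+> UNIV) \<Longrightarrow> set a \<subseteq> A \<Longrightarrow> plug a \<phi> \<in> fmlas L (UNIV <+> A)"
  unfolding plug_def by (erule fmlas_rename) (auto simp: subset_iff)

lemma holds_case_sum_cong:
  assumes "\<phi> \<in> fmlas L (V <+> A)" "\<And>x. x \<in> V \<Longrightarrow> v x = v' x" "\<And>x. x \<in> A \<Longrightarrow> w x = w' x"
  shows "holds M (case_sum v w) \<phi> \<longleftrightarrow> holds M (case_sum v' w') \<phi>"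
  by (rule sat_cong) (use assms in \<open>auto dest!: fmlas_vars[OF assms(1)]\<close>)

lemma holds_case_sum_Aut:
  assumes "is_struct L M" "g \<in> Aut L M" "\<phi> \<in> fmlas L (V <+> A)"
    and "v ` V \<subseteq> univ M" "w ` A \<subseteq> univ M"
  shows "holds M (case_sum (g \<circ> v) (g \<circ> w)) \<phi> \<longleftrightarrow> holds M (case_sum v w) \<phi>"
proof -
  have "case_sum v w ` (V <+> A) \<subseteq> univ M" using assms(4,5) by auto
  moreover have "g \<circ> case_sum v w = case_sum (g \<circ> v) (g \<circ> w)"
    by (auto simp: fun_eq_iff split: sum.split)
  ultimately show ?thesis using holds_Aut[OF assms(1-3)] by metis
qed

lemma holds_tuple_Aut:
  assumes "is_struct L M" "g \<in> Aut L M" "\<phi> \<in> fmlas L ({..<length a} <+> A)"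
    and "set a \<subseteq> univ M" "w ` A \<subseteq> univ M"
  shows "holds M (case_sum (\<lambda>k. map g a ! k) (g \<circ> w)) \<phi> \<longleftrightarrow> holds M (case_sum (\<lambda>k. a ! k) w) \<phi>"
proof -
  have "(\<lambda>k. a ! k) ` {..<length a} \<subseteq> univ M" using assms(4) by auto
  then have "holds M (case_sum (g \<circ> (\<lambda>k. a ! k)) (g \<circ> w)) \<phi> \<longleftrightarrow> holds M (case_sum (\<lambda>k. a ! k) w) \<phi>"
    by (rule holds_case_sum_Aut[OF assms(1-3) _ assms(5)])
  \<comment> \<open>Past the end of the list, \<open>map g a ! k\<close> and
    \<open>g (a ! k)\<close> may differ; the variables of \<phi> stay below
    \<open>length a\<close>.\<close>
  moreover have "holds M (case_sum (g \<circ> (\<lambda>k. a ! k)) (g \<circ> w)) \<phi>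
      \<longleftrightarrow> holds M (case_sum (\<lambda>k. map g a ! k) (g \<circ> w)) \<phi>"
    by (rule holds_case_sum_cong[OF assms(3)]) auto
  ultimately show ?thesis by blast
qed

lemma tuple_tp_Aut:
  assumes "is_struct L M" "g \<in> Aut L M" "set a \<subseteq> univ M"
  shows "tuple_tp L M {} (map g a) = tuple_tp L M {} a"
proof -
  have "holds M (case_sum (\<lambda>k. map g a ! k) id) \<phi> \<longleftrightarrow> holds M (case_sum (\<lambda>k. a ! k) id) \<phi>"
    if "\<phi> \<in> fmlas L ({..<length a} <+> {})" for \<phi>
    using holds_tuple_Aut[OF assms(1,2) that assms(3), of id]
      holds_case_sum_cong[OF that, of "\<lambda>k. map g a ! k" "\<lambda>k. map g a ! k" "g \<circ> id" id M]
    by simp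
  then show ?thesis by (auto simp: tuple_tp_def tp_def)
qed

lemma tuple_tp_in_type_space:
  "set a \<subseteq> univ M \<Longrightarrow> tuple_tp L M A a \<in> type_space L M A {..<length a}"
  unfolding tuple_tp_def by (rule tp_in_type_space) auto

section \<open>The action of automorphisms on global types\<close>

lemma rename_Aut_in_fmlas:
  assumes "\<phi> \<in> fmlas L (V <+> univ M)" "g \<in> Aut L M"
  shows "rename (map_sum id g) \<phi> \<in> fmlas L (V <+> univ M)"
  using assms(1) by (rule fmlas_rename) (use Aut_in_univ[OF assms(2)] in auto)

lemma rename_inverse_Aut:
  assumes "\<phi> \<in> fmlas L (V <+> univ M)" "\<And>x. x \<in> univ M \<Longrightarrow> g (h x) = x"
  shows "rename (map_sum id g) (rename (map_sum id h) \<phi>) = \<phi>"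
  unfolding rename_rename by (rule rename_idem) (auto dest!: fmlas_vars[OF assms(1)] simp: assms(2))

lemma act_memI: "\<psi> \<in> r \<Longrightarrow> rename (map_sum id g) \<psi> = \<phi> \<Longrightarrow> \<phi> \<in> act g r"
  by (auto simp: act_def)

text \<open>Since \<open>act\<close> is an image, the inclusion from right to left needs a preimage
  of each formula; renaming the parameters by the inverse automorphism \<open>h\<close> supplies
  it.\<close>

lemma act_tp:
  assumes "is_struct L M" "g \<in> Aut L M" "v ` V \<subseteq> univ M"
  shows "act g (tp L M (univ M) V v) = tp L M (univ M) V (g \<circ> v)"
proof -
  have holds: "holds M (case_sum (g \<circ> v) id) (rename (map_sum id g) \<phi>) \<longleftrightarrow> holds M (case_sum v id) \<phi>"
    if "\<phi> \<in> fmlas L (V <+> univ M)" for \<phi>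
    using holds_case_sum_Aut[OF assms(1,2) that assms(3), of id]
    by (simp add: holds_rename_map_sum del: o_apply)
  obtain h where h: "h \<in> Aut L M" "\<And>x. x \<in> univ M \<Longrightarrow> g (h x) = x"
    using Aut_inverse[OF assms(1,2)] by metis
  show ?thesis
  proof
    show "act g (tp L M (univ M) V v) \<subseteq> tp L M (univ M) V (g \<circ> v)"
      unfolding act_def
    proof safe
      fix \<phi> assume "\<phi> \<in> tp L M (univ M) V v"
      then show "rename (map_sum id g) \<phi> \<in> tp L M (univ M) V (g \<circ> v)"
        using holds[of \<phi>] rename_Aut_in_fmlas[of \<phi> L V M g] assms(2) unfolding tp_def by blast
    qed
    show "tp L M (univ M) V (g \<circ> v) \<subseteq> act g (tp L M (univ M) V v)"
    proof
      fix \<phi> assume \<phi>: "\<phi> \<in> tp L M (univ M) V (g \<circ> v)"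
      then have f: "\<phi> \<in> fmlas L (V <+> univ M)" by (simp add: tp_def)
      have gh: "rename (map_sum id g) (rename (map_sum id h) \<phi>) = \<phi>"
        by (rule rename_inverse_Aut[OF f]) (rule h(2))
      have "rename (map_sum id h) \<phi> \<in> tp L M (univ M) V v"
        using \<phi> holds[OF rename_Aut_in_fmlas[OF f h(1)]] rename_Aut_in_fmlas[OF f h(1)]
        unfolding gh tp_def by blast
      then show "\<phi> \<in> act g (tp L M (univ M) V v)"
        using gh by (rule act_memI)
    qed
  qed
qed

text \<open>Recasts invariance as biconditionals, the shape that \<open>type_space_extend\<close>
  can impose. From left to right, formulas outside \<open>r\<close> are treated through their
  negations, which lie in \<open>r\<close>.\<close>

lemma act_eq_iff:
  assumes "is_struct L M" "g \<in> Aut L M" "r \<in> type_space L M (univ M) V"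
  shows "act g r = r \<longleftrightarrow> (\<forall>\<phi>\<in>fmlas L (V <+> univ M). \<phi> \<in> r \<longleftrightarrow> rename (map_sum id g) \<phi> \<in> r)"
proof
  assume inv: "act g r = r"
  have "rename (map_sum id g) \<phi> \<in> r" if "\<phi> \<in> r" for \<phi>
    using inv that unfolding act_def by blast
  moreover have "rename (map_sum id g) \<phi> \<notin> r" if "\<phi> \<notin> r" "\<phi> \<in> fmlas L (V <+> univ M)" for \<phi>
  proof -
    have "rename (map_sum id g) (Neg \<phi>) \<in> r"
      using calculation[of "Neg \<phi>"] type_space_Neg[OF assms(3) that(2)] that(1) by blast
    then show ?thesis
      using type_space_Neg[OF assms(3) rename_Aut_in_fmlas[OF that(2) assms(2)]] by simp
  qed
  ultimately show "\<forall>\<phi>\<in>fmlas L (V <+> univ M). \<phi> \<in> r \<longleftrightarrow> rename (map_sum id g) \<phi> \<in> r"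
    by blast
next
  assume inv: "\<forall>\<phi>\<in>fmlas L (V <+> univ M). \<phi> \<in> r \<longleftrightarrow> rename (map_sum id g) \<phi> \<in> r"
  obtain h where h: "h \<in> Aut L M" "\<And>x. x \<in> univ M \<Longrightarrow> g (h x) = x"
    using Aut_inverse[OF assms(1,2)] by metis
  have "\<phi> \<in> act g r" if "\<phi> \<in> r" for \<phi>
  proof -
    have f: "\<phi> \<in> fmlas L (V <+> univ M)" using assms(3) that type_space_fmlas by blast
    have "rename (map_sum id g) (rename (map_sum id h) \<phi>) = \<phi>"
      by (rule rename_inverse_Aut[OF f]) (rule h(2))
    moreover from this have "rename (map_sum id h) \<phi> \<in> r"
      using inv rename_Aut_in_fmlas[OF f h(1)] that by auto
    ultimately show ?thesis by (blast intro: act_memI)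
  qed
  moreover have "\<phi> \<in> r" if "\<phi> \<in> act g r" for \<phi>
    using that inv type_space_fmlas[OF assms(3)] unfolding act_def by blast
  ultimately show "act g r = r" by blast
qed

lemma act_in_type_space:
  assumes "is_struct L M" "g \<in> Aut L M" "r \<in> type_space L M (univ M) V"
  shows "act g r \<in> type_space L M (univ M) V"
proof -
  have "act g r \<subseteq> fmlas L (V <+> univ M)"
    using rename_Aut_in_fmlas[OF _ assms(2)] type_space_fmlas[OF assms(3)] by (auto simp: act_def)
  moreover have "finitely_satisfiable M V (act g r)"
    unfolding finitely_satisfiable_def
  proof (intro allI impI)
    fix F assume "finite F \<and> F \<subseteq> act g r"
    then obtain F' where F': "F' \<subseteq> r" "finite F'" "F = rename (map_sum id g) ` F'"
      unfolding act_def using finite_subset_image by metis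
    then obtain v where v: "v \<in> V \<rightarrow> univ M" "\<forall>\<phi>\<in>F'. holds M (case_sum v id) \<phi>"
      using type_space_satisfiable[OF assms(3)] by metis
    have "holds M (case_sum (g \<circ> v) id) (rename (map_sum id g) \<phi>)" if "\<phi> \<in> F'" for \<phi>
    proof -
      have "\<phi> \<in> fmlas L (V <+> univ M)" using that F'(1) type_space_fmlas[OF assms(3)] by blast
      then show ?thesis
        using holds_case_sum_Aut[OF assms(1,2), of \<phi> V "univ M" v id] v that
        by (auto simp: holds_rename_map_sum simp del: o_apply)
    qed
    moreover have "g \<circ> v \<in> V \<rightarrow> univ M" using v(1) Aut_in_univ[OF assms(2)] by (auto simp: Pi_iff)
    ultimately show "\<exists>v\<in>V \<rightarrow> univ M. \<forall>\<phi>\<in>F. holds M (case_sum v id) \<phi>"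
      unfolding F'(3) by blast
  qed
  moreover have "\<phi> \<in> act g r \<or> Neg \<phi> \<in> act g r" if f: "\<phi> \<in> fmlas L (V <+> univ M)" for \<phi>
  proof -
    obtain h where h: "h \<in> Aut L M" "\<And>x. x \<in> univ M \<Longrightarrow> g (h x) = x"
      using Aut_inverse[OF assms(1,2)] by metis
    have "rename (map_sum id h) \<phi> \<in> r \<or> Neg (rename (map_sum id h) \<phi>) \<in> r"
      using rename_Aut_in_fmlas[OF f h(1)] assms(3) by (auto simp: type_space_def)
    moreover have "rename (map_sum id g) (rename (map_sum id h) \<phi>) = \<phi>"
      by (rule rename_inverse_Aut[OF f]) (rule h(2))
    moreover from this have "rename (map_sum id g) (Neg (rename (map_sum id h) \<phi>)) = Neg \<phi>"
      by simp
    ultimately show ?thesis by (blast intro: act_memI)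
  qed
  ultimately show ?thesis by (auto simp: type_space_def)
qed

text \<open>Formulas without parameters are fixed by the renaming, so the part of the type over the
  empty set stays in place.\<close>

lemma act_in_S_ext:
  assumes "is_struct L M" "g \<in> Aut L M" "r \<in> S_ext L M c"
  shows "act g r \<in> S_ext L M c"
proof -
  have "\<phi> \<in> act g r" if \<phi>: "\<phi> \<in> tp L M {} UNIV c" for \<phi>
  proof -
    have "\<phi> \<in> fmlas L (UNIV <+> {})" using \<phi> by (simp add: tp_def)
    then have "rename (map_sum id g) \<phi> = \<phi>"
      by (intro rename_idem) (auto dest!: fmlas_vars)
    moreover have "\<phi> \<in> r" using \<phi> assms(3) by (auto simp: S_ext_def)
    ultimately show ?thesis by (blast intro: act_memI)
  qed
  then show ?thesis using act_in_type_space assms by (auto simp: S_ext_def)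
qed

lemma S_ext_type_space: "p \<in> S_ext L M c \<Longrightarrow> p \<in> type_space L M (univ M) UNIV"
  by (simp add: S_ext_def)

lemma S_ext_tp_iff:
  assumes "p \<in> S_ext L M c" "\<phi> \<in> fmlas L (UNIV <+> {})"
  shows "\<phi> \<in> p \<longleftrightarrow> holds M (case_sum c id) \<phi>"
proof -
  have "\<phi> \<in> tp L M {} UNIV c \<or> Neg \<phi> \<in> tp L M {} UNIV c"
    using assms(2) by (auto simp: tp_def)
  moreover have "tp L M {} UNIV c \<subseteq> p"
    using assms(1) by (simp add: S_ext_def)
  moreover have "\<phi> \<in> fmlas L (UNIV <+> univ M)"
    using assms(2) by (rule fmlas_mono) auto
  ultimately show ?thesis
    using type_space_Neg[OF S_ext_type_space[OF assms(1)], of \<phi>] by (auto simp: tp_def subset_iff)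
qed

text \<open>Compactness for all automorphisms at once. A finite set of pairs \<phi>, g\<phi> is
  enlarged to a full rectangle \<open>D \<times> G\<close> of formulas and automorphisms, which
  leaves the caller a uniform finite task.\<close>

lemma invariant_type_exists:
  fixes L :: "('f, 'r) language" and M :: "('f, 'r, 'm) struct" and V :: "'v set"
  assumes struct: "is_struct L M" and \<Gamma>: "\<Gamma> \<subseteq> fmlas L (V <+> univ M)"
    and approx: "\<And>\<Gamma>\<^sub>0 D G. finite \<Gamma>\<^sub>0 \<Longrightarrow> \<Gamma>\<^sub>0 \<subseteq> \<Gamma> \<Longrightarrow> finite D \<Longrightarrow> D \<subseteq> fmlas L (V <+> univ M) \<Longrightarrow>
      finite G \<Longrightarrow> G \<subseteq> Aut L M \<Longrightarrow>
      \<exists>v \<in> V \<rightarrow> univ M. (\<forall>\<phi>\<in>\<Gamma>\<^sub>0. holds M (case_sum v id) \<phi>) \<and>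
        (\<forall>\<phi>\<in>D. \<forall>g\<in>G. holds M (case_sum v id) \<phi> \<longleftrightarrow>
           holds M (case_sum v id) (rename (map_sum id g) \<phi>))"
  shows "\<exists>r \<in> type_space L M (univ M) V. \<Gamma> \<subseteq> r \<and> (\<forall>g\<in>Aut L M. act g r = r)"
proof -
  define e where "e = (\<lambda>(\<phi> :: ('f, 'r, 'v + 'm) fm, g :: 'm \<Rightarrow> 'm). (\<phi>, rename (map_sum id g) \<phi>))"
  define E where "E = e ` (fmlas L (V <+> univ M) \<times> Aut L M)"
  have "\<exists>r \<in> type_space L M (univ M) V. \<Gamma> \<subseteq> r \<and> (\<forall>(\<phi>, \<psi>)\<in>E. \<phi> \<in> r \<longleftrightarrow> \<psi> \<in> r)"
  proof (rule type_space_extend[OF \<Gamma>])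
    show "\<phi> \<in> fmlas L (V <+> univ M) \<and> \<psi> \<in> fmlas L (V <+> univ M)" if "(\<phi>, \<psi>) \<in> E" for \<phi> \<psi>
      using that rename_Aut_in_fmlas by (auto simp: E_def e_def)
    fix \<Gamma>\<^sub>0 E\<^sub>0 assume fin: "finite \<Gamma>\<^sub>0" "\<Gamma>\<^sub>0 \<subseteq> \<Gamma>" "finite E\<^sub>0" "E\<^sub>0 \<subseteq> E"
    then obtain C where C: "C \<subseteq> fmlas L (V <+> univ M) \<times> Aut L M" "finite C" "E\<^sub>0 = e ` C"
      unfolding E_def using finite_subset_image by metis
    have "fst ` C \<subseteq> fmlas L (V <+> univ M)" "snd ` C \<subseteq> Aut L M"
      using C(1) by auto
    then obtain v where v: "v \<in> V \<rightarrow> univ M" "\<forall>\<phi>\<in>\<Gamma>\<^sub>0. holds M (case_sum v id) \<phi>"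
      "\<forall>\<phi>\<in>fst ` C. \<forall>g\<in>snd ` C. holds M (case_sum v id) \<phi> \<longleftrightarrow>
           holds M (case_sum v id) (rename (map_sum id g) \<phi>)"
      using approx[OF fin(1,2), of "fst ` C" "snd ` C"] C(2) by blast
    have "\<forall>(\<phi>, \<psi>)\<in>E\<^sub>0. holds M (case_sum v id) \<phi> \<longleftrightarrow> holds M (case_sum v id) \<psi>"
      unfolding C(3) e_def using v(3) by force
    then show "\<exists>v\<in>V \<rightarrow> univ M. (\<forall>\<phi>\<in>\<Gamma>\<^sub>0. holds M (case_sum v id) \<phi>) \<and>
        (\<forall>(\<phi>, \<psi>)\<in>E\<^sub>0. holds M (case_sum v id) \<phi> \<longleftrightarrow> holds M (case_sum v id) \<psi>)"
      using v(1,2) by blast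
  qed
  then obtain r where r: "r \<in> type_space L M (univ M) V" "\<Gamma> \<subseteq> r"
    "\<And>\<phi> \<psi>. (\<phi>, \<psi>) \<in> E \<Longrightarrow> \<phi> \<in> r \<longleftrightarrow> \<psi> \<in> r"
    by blast
  have "act g r = r" if g: "g \<in> Aut L M" for g
  proof -
    have "(\<phi>, rename (map_sum id g) \<phi>) \<in> E" if "\<phi> \<in> fmlas L (V <+> univ M)" for \<phi>
      unfolding E_def e_def using g that by force
    then show ?thesis using act_eq_iff[OF struct g r(1)] r(3) by blast
  qed
  then show ?thesis using r(1,2) by blast
qed

section \<open>Finite saturation and homogeneity\<close>

text \<open>Isolating these properties keeps the cardinal \<kappa> out of the argument; it enters
  only when a monster model is shown to be an instance.\<close>

locale homogeneous_struct =
  fixes L :: "('f, 'r) language" and M :: "('f, 'r, 'm) struct"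
  assumes struct: "is_struct L M"
    and realizations_nonempty: "\<lbrakk>A \<subseteq> univ M; finite A; p \<in> type_space L M A {..<n}\<rbrakk> \<Longrightarrow>
      realizations L M A n p \<noteq> {}"
    and homogeneous: "\<lbrakk>A \<subseteq> univ M; finite A; elementary_map L M A h\<rbrakk> \<Longrightarrow>
      \<exists>g \<in> Aut L M. \<forall>x\<in>A. g x = h x"
begin

lemma tuples_conjugate:
  assumes a: "set a \<subseteq> univ M" and b: "set b \<subseteq> univ M" and len: "length a = length b"
    and tp: "tuple_tp L M {} a = tuple_tp L M {} b"
  obtains g where "g \<in> Aut L M" "map g a = b"
proof -
  have same: "holds M (case_sum (\<lambda>k. a ! k) id) \<phi> \<longleftrightarrow> holds M (case_sum (\<lambda>k. b ! k) id) \<phi>"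
    if "\<phi> \<in> fmlas L ({..<length a} <+> {})" for \<phi>
    using tp that len by (auto simp: tuple_tp_def tp_def)
  define idx where "idx x = (SOME k. k < length a \<and> a ! k = x)" for x
  have idx: "idx x < length a" "a ! idx x = x" if "x \<in> set a" for x
    using that someI_ex[of "\<lambda>k. k < length a \<and> a ! k = x"] by (auto simp: idx_def in_set_conv_nth)
  define h where "h = (\<lambda>x. b ! idx x)"
  have hb: "h (a ! k) = b ! k" if k: "k < length a" for k
  proof -
    \<comment> \<open>The list \<open>a\<close> may repeat entries, so \<open>idx (a ! k)\<close>
      need not be \<open>k\<close>. That the two coordinates are equal is part of the type of
      \<open>a\<close>, hence true of \<open>b\<close>, and makes \<open>h\<close> well
      behaved.\<close>
    have "Eq (Var (Inl (idx (a ! k)))) (Var (Inl k)) \<in> fmlas L ({..<length a} <+> {})"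
      using idx[of "a ! k"] k by (auto simp: fmlas_def)
    from same[OF this] show ?thesis
      using idx(2)[of "a ! k"] k by (simp add: h_def)
  qed
  have "elementary_map L M (set a) h"
    unfolding elementary_map_def
  proof (intro conjI ballI)
    show "h ` set a \<subseteq> univ M"
      using idx b len by (auto simp: h_def)
    fix \<phi> assume \<phi>: "\<phi> \<in> fmlas L (set a)"
    have "rename (\<lambda>x. Inl (idx x)) \<phi> \<in> fmlas L ({..<length a} <+> {})"
      using \<phi> by (rule fmlas_rename) (use idx in auto)
    from same[OF this] have "holds M (\<lambda>x. a ! idx x) \<phi> \<longleftrightarrow> holds M h \<phi>"
      by (simp add: sat_rename comp_def h_def)
    moreover have "holds M (\<lambda>x. a ! idx x) \<phi> \<longleftrightarrow> holds M id \<phi>"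
      by (rule sat_cong) (use fmlas_vars[OF \<phi>] idx(2) in auto)
    ultimately show "holds M id \<phi> \<longleftrightarrow> holds M h \<phi>" by blast
  qed
  then obtain g where g: "g \<in> Aut L M" "\<forall>x\<in>set a. g x = h x"
    using homogeneous a by blast
  then have "map g a = b"
    using hb len by (intro nth_equalityI) auto
  then show ?thesis using g(1) that by blast
qed

text \<open>Density of the orbit of tp(c) in \<open>S_ext\<close>. Only the coordinates and
  parameters occurring in \<open>D\<close> matter. Saturation realizes the corresponding finite part
  of \<open>p\<close> by a tuple \<open>b\<close>; homogeneity then moves the matching entries of
  \<open>c\<close> onto \<open>b\<close>, the rest of \<open>c\<close> following along.\<close>

lemma S_ext_approx:
  assumes c: "range c \<subseteq> univ M" and p: "p \<in> S_ext L M c"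
    and D: "finite D" "D \<subseteq> fmlas L (UNIV <+> univ M)"
  obtains g where "g \<in> Aut L M" "\<And>\<phi>. \<phi> \<in> D \<Longrightarrow> \<phi> \<in> p \<longleftrightarrow> holds M (case_sum (g \<circ> c) id) \<phi>"
proof -
  note pT = S_ext_type_space[OF p]
  define X where "X = (\<Union>\<phi>\<in>D. fm_vars \<phi>)"
  have "finite X" using D(1) by (simp add: X_def finite_fm_vars)
  moreover have "X \<subseteq> UNIV <+> univ M"
    using D(2) unfolding X_def fmlas_def by blast
  ultimately have X: "finite X" "X \<subseteq> UNIV <+> univ M" by auto
  define A where "A = Inr -` X"
  have A: "finite A" "A \<subseteq> univ M"
    using X by (auto simp: A_def intro: finite_vimageI)
  have "finite (Inl -` X)" using X(1) by (auto intro: finite_vimageI)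
  then obtain js where js: "set js = Inl -` X" using finite_list by blast
  define n where "n = length js"
  define idx where "idx i = (SOME k. k < n \<and> js ! k = i)" for i
  have idx: "idx i < n \<and> js ! idx i = i" if "Inl i \<in> X" for i
    unfolding idx_def
    by (rule someI_ex) (use that js in \<open>auto simp: n_def in_set_conv_nth dest: vimageI2\<close>)
  \<comment> \<open>Reads the variable \<open>k\<close> as the coordinate \<open>js ! k\<close> of
    \<open>c\<close>; renaming by \<open>idx\<close> goes back.\<close>
  define \<rho> where "\<rho> \<psi> = rename (map_sum (\<lambda>k. js ! k) (id :: 'm \<Rightarrow> 'm)) \<psi>" for \<psi> :: "('f, 'r, nat + 'm) fm"
  have \<rho>_fmlas: "\<rho> \<psi> \<in> fmlas L (UNIV <+> univ M)" if "\<psi> \<in> fmlas L ({..<n} <+> A)" for \<psi>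
    unfolding \<rho>_def using that by (rule fmlas_rename) (use A in auto)
  define q where "q = {\<psi> \<in> fmlas L ({..<n} <+> A). \<rho> \<psi> \<in> p}"
  have "finitely_satisfiable M {..<n} q"
    unfolding finitely_satisfiable_def
  proof (intro allI impI)
    fix F assume F: "finite F \<and> F \<subseteq> q"
    then have "finite (\<rho> ` F)" "\<rho> ` F \<subseteq> p" by (auto simp: q_def)
    then obtain v where v: "v \<in> UNIV \<rightarrow> univ M" "\<forall>\<phi>\<in>\<rho> ` F. holds M (case_sum v id) \<phi>"
      using type_space_satisfiable[OF pT] by metis
    have "holds M (case_sum (v \<circ> (\<lambda>k. js ! k)) id) \<psi>" if "\<psi> \<in> F" for \<psi>
      using v(2) that by (auto simp: \<rho>_def holds_rename_map_sum simp del: o_apply)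
    moreover have "v \<circ> (\<lambda>k. js ! k) \<in> {..<n} \<rightarrow> univ M" using v(1) by auto
    ultimately show "\<exists>v\<in>{..<n} \<rightarrow> univ M. \<forall>\<phi>\<in>F. holds M (case_sum v id) \<phi>" by blast
  qed
  moreover have "\<psi> \<in> q \<or> Neg \<psi> \<in> q" if "\<psi> \<in> fmlas L ({..<n} <+> A)" for \<psi>
    using that type_space_Neg[OF pT \<rho>_fmlas[OF that]] by (auto simp: q_def \<rho>_def)
  ultimately have "q \<in> type_space L M A {..<n}"
    by (auto simp: type_space_def q_def)
  then obtain b where b: "length b = n" "set b \<subseteq> univ M" "tuple_tp L M A b = q"
    using realizations_nonempty[OF A(2,1)] by (auto simp: realizations_def)
  have bq: "\<rho> \<psi> \<in> p \<longleftrightarrow> holds M (case_sum (\<lambda>k. b ! k) id) \<psi>" if "\<psi> \<in> fmlas L ({..<n} <+> A)" for \<psi>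
    using b that by (auto simp: tuple_tp_def tp_def q_def)
  \<comment> \<open>As \<open>p\<close> extends the type of \<open>c\<close> over the empty set, it
    decides parameter-free formulas as \<open>c\<close> does. Hence \<open>b\<close> and the chosen
    entries of \<open>c\<close> are conjugate.\<close>
  have "holds M (case_sum (\<lambda>k. map c js ! k) id) \<psi> \<longleftrightarrow> holds M (case_sum (\<lambda>k. b ! k) id) \<psi>"
    if \<psi>: "\<psi> \<in> fmlas L ({..<n} <+> {})" for \<psi>
  proof -
    have "\<rho> \<psi> \<in> fmlas L (UNIV <+> {})"
      unfolding \<rho>_def using \<psi> by (rule fmlas_rename) auto
    then have "\<rho> \<psi> \<in> p \<longleftrightarrow> holds M (case_sum c id) (\<rho> \<psi>)"
      by (rule S_ext_tp_iff[OF p])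
    also have "\<dots> \<longleftrightarrow> holds M (case_sum (c \<circ> (\<lambda>k. js ! k)) (id \<circ> id)) \<psi>"
      by (simp only: \<rho>_def holds_rename_map_sum)
    also have "\<dots> \<longleftrightarrow> holds M (case_sum (\<lambda>k. map c js ! k) id) \<psi>"
      by (rule holds_case_sum_cong[OF \<psi>]) (auto simp: n_def)
    finally show ?thesis using bq[of \<psi>] fmlas_mono[OF \<psi>, of "{..<n} <+> A"] by auto
  qed
  then have "tuple_tp L M {} (map c js) = tuple_tp L M {} b"
    using b(1) by (auto simp: tuple_tp_def tp_def n_def)
  moreover have "set (map c js) \<subseteq> univ M" using c by auto
  ultimately obtain g where g: "g \<in> Aut L M" "map g (map c js) = b"
    using tuples_conjugate b(1,2) by (metis length_map n_def)
  have "\<phi> \<in> p \<longleftrightarrow> holds M (case_sum (g \<circ> c) id) \<phi>" if \<phi>: "\<phi> \<in> D" for \<phi>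
  proof -
    define \<psi> where "\<psi> = rename (map_sum idx (id :: 'm \<Rightarrow> 'm)) \<phi>"
    have vars: "x \<in> X" if "x \<in> fm_vars \<phi>" for x using \<phi> that by (auto simp: X_def)
    have "\<phi> \<in> fmlas L X" using D(2) \<phi> vars by (auto intro: fmlas_restrict)
    then have \<psi>: "\<psi> \<in> fmlas L ({..<n} <+> A)"
      unfolding \<psi>_def by (rule fmlas_rename) (use idx A_def in \<open>auto simp: map_sum_def split: sum.split\<close>)
    have "\<rho> \<psi> = \<phi>"
      unfolding \<rho>_def \<psi>_def rename_rename
      by (rule rename_idem) (use idx vars in \<open>auto simp: map_sum_def split: sum.split\<close>)
    then have "\<phi> \<in> p \<longleftrightarrow> holds M (case_sum (\<lambda>k. b ! k) id) \<psi>"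
      using bq[OF \<psi>] by simp
    also have "\<dots> \<longleftrightarrow> holds M (case_sum ((\<lambda>k. b ! k) \<circ> idx) (id \<circ> id)) \<phi>"
      by (simp only: \<psi>_def holds_rename_map_sum)
    also have "\<dots> \<longleftrightarrow> holds M (case_sum (g \<circ> c) id) \<phi>"
    proof (rule sat_cong)
      fix x assume "x \<in> fm_vars \<phi>"
      then have "x \<in> X" by (rule vars)
      then show "case_sum ((\<lambda>k. b ! k) \<circ> idx) (id \<circ> id) x = case_sum (g \<circ> c) id x"
        using idx g(2)[symmetric] by (auto simp: n_def split: sum.split)
    qed
    finally show ?thesis .
  qed
  then show ?thesis using that g(1) by blast
qed

section \<open>DEERP and \<open>q\<close>-invariant types\<close>

text \<open>The analogue of \<open>invariant_type_exists\<close> for a single \<open>q\<close>: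
  realizations of \<open>q\<close> take the place of automorphisms, and both members of each finite
  family of pairs are collected into one set \<open>R\<close>.\<close>

lemma Inv_q_nonempty_if_approx:
  fixes c :: "'i \<Rightarrow> 'm"
  assumes approx: "\<And>\<Gamma> D R. finite \<Gamma> \<Longrightarrow> \<Gamma> \<subseteq> tp L M {} UNIV c \<Longrightarrow>
      finite D \<Longrightarrow> D \<subseteq> fmlas L ({..<n} <+> UNIV) \<Longrightarrow> finite R \<Longrightarrow> R \<subseteq> realizations L M {} n q \<Longrightarrow>
      \<exists>v \<in> UNIV \<rightarrow> univ M. (\<forall>\<phi>\<in>\<Gamma>. holds M (case_sum v id) \<phi>) \<and>
        (\<forall>\<phi>\<in>D. \<forall>a\<in>R. \<forall>a'\<in>R. holds M (case_sum v id) (plug a \<phi>) \<longleftrightarrow>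
           holds M (case_sum v id) (plug a' \<phi>))"
  shows "Inv_q L M n q c \<noteq> {}"
proof -
  define e where "e = (\<lambda>(\<phi> :: ('f, 'r, nat + 'i) fm, a :: 'm list, a' :: 'm list). (plug a \<phi>, plug a' \<phi>))"
  define R where "R = realizations L M {} n q"
  define E where "E = e ` (fmlas L ({..<n} <+> UNIV) \<times> R \<times> R)"
  have plug: "plug a \<phi> \<in> fmlas L (UNIV <+> univ M)"
    if "\<phi> \<in> fmlas L ({..<n} <+> UNIV)" "a \<in> R" for a and \<phi> :: "('f, 'r, nat + 'i) fm"
    using that by (intro plug_in_fmlas) (auto simp: R_def realizations_def)
  have "\<exists>p \<in> type_space L M (univ M) UNIV. tp L M {} UNIV c \<subseteq> p \<and>
      (\<forall>(\<phi>, \<psi>)\<in>E. \<phi> \<in> p \<longleftrightarrow> \<psi> \<in> p)"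
  proof (rule type_space_extend)
    show "tp L M {} UNIV c \<subseteq> fmlas L (UNIV <+> univ M)"
      by (auto simp: tp_def intro: fmlas_mono)
    show "\<phi> \<in> fmlas L (UNIV <+> univ M) \<and> \<psi> \<in> fmlas L (UNIV <+> univ M)"
      if "(\<phi>, \<psi>) \<in> E" for \<phi> \<psi>
      using that plug by (auto simp: E_def e_def)
    fix \<Gamma> E\<^sub>0 assume fin: "finite \<Gamma>" "\<Gamma> \<subseteq> tp L M {} UNIV c" "finite E\<^sub>0" "E\<^sub>0 \<subseteq> E"
    then obtain C where C: "C \<subseteq> fmlas L ({..<n} <+> UNIV) \<times> R \<times> R" "finite C" "E\<^sub>0 = e ` C"
      unfolding E_def using finite_subset_image by metis
    define R\<^sub>0 where "R\<^sub>0 = (fst \<circ> snd) ` C \<union> (snd \<circ> snd) ` C"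
    have "fst ` C \<subseteq> fmlas L ({..<n} <+> UNIV)" "R\<^sub>0 \<subseteq> R" "finite R\<^sub>0"
      using C(1,2) by (auto simp: R\<^sub>0_def)
    then obtain v where v: "v \<in> UNIV \<rightarrow> univ M" "\<forall>\<phi>\<in>\<Gamma>. holds M (case_sum v id) \<phi>"
      "\<forall>\<phi>\<in>fst ` C. \<forall>a\<in>R\<^sub>0. \<forall>a'\<in>R\<^sub>0. holds M (case_sum v id) (plug a \<phi>) \<longleftrightarrow>
           holds M (case_sum v id) (plug a' \<phi>)"
      using approx[OF fin(1,2), of "fst ` C" R\<^sub>0] C(2) unfolding R_def by blast
    have "holds M (case_sum v id) (plug a \<phi>) \<longleftrightarrow> holds M (case_sum v id) (plug a' \<phi>)"
      if "(\<phi>, a, a') \<in> C" for \<phi> a a'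
    proof -
      have "\<phi> \<in> fst ` C" "a \<in> R\<^sub>0" "a' \<in> R\<^sub>0"
        using that by (force simp: R\<^sub>0_def)+
      then show ?thesis using v(3) by blast
    qed
    then have "\<forall>(\<phi>, \<psi>)\<in>E\<^sub>0. holds M (case_sum v id) \<phi> \<longleftrightarrow> holds M (case_sum v id) \<psi>"
      unfolding C(3) e_def by auto
    then show "\<exists>v\<in>UNIV \<rightarrow> univ M. (\<forall>\<phi>\<in>\<Gamma>. holds M (case_sum v id) \<phi>) \<and>
        (\<forall>(\<phi>, \<psi>)\<in>E\<^sub>0. holds M (case_sum v id) \<phi> \<longleftrightarrow> holds M (case_sum v id) \<psi>)"
      using v(1,2) by blast
  qed
  then obtain p where p: "p \<in> type_space L M (univ M) UNIV" "tp L M {} UNIV c \<subseteq> p"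
    "\<And>\<phi> \<psi>. (\<phi>, \<psi>) \<in> E \<Longrightarrow> \<phi> \<in> p \<longleftrightarrow> \<psi> \<in> p"
    by blast
  have "plug a \<phi> \<in> p \<longleftrightarrow> plug a' \<phi> \<in> p"
    if "\<phi> \<in> fmlas L ({..<n} <+> UNIV)" "a \<in> R" "a' \<in> R" for \<phi> a a'
  proof (rule p(3))
    have "(plug a \<phi>, plug a' \<phi>) = e (\<phi>, a, a')" by (simp add: e_def)
    then show "(plug a \<phi>, plug a' \<phi>) \<in> E" unfolding E_def using that by blast
  qed
  then have "p \<in> Inv_q L M n q c"
    using p(1,2) unfolding Inv_q_def S_ext_def R_def by blast
  then show ?thesis by blast
qed

text \<open>One color bit is spent on each formula of \<open>D\<close>, evaluated at y = c. If
  \<open>g\<close> carries \<open>b\<close> to the homogeneous copy \<open>b'\<close>, the truth of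
  \<phi>(g a, c) does not depend on \<open>a\<close> in \<open>R\<close>. Pulled back by the inverse
  \<open>h\<close> of \<open>g\<close>, neither does that of \<phi>(a, h c), so
  \<open>h \<circ> c\<close> is the approximation sought.\<close>

lemma Inv_q_nonempty_if_type_DEERP:
  fixes c :: "'i \<Rightarrow> 'm"
  assumes c: "range c \<subseteq> univ M" and deerp: "type_DEERP L M n q"
  shows "Inv_q L M n q c \<noteq> {}"
proof (rule Inv_q_nonempty_if_approx)
  fix \<Gamma> :: "('f, 'r, 'i + 'm) fm set" and D :: "('f, 'r, nat + 'i) fm set" and R
  assume \<Gamma>: "\<Gamma> \<subseteq> tp L M {} UNIV c"
    and D: "finite D" "D \<subseteq> fmlas L ({..<n} <+> UNIV)"
    and R: "finite R" "R \<subseteq> realizations L M {} n q"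
  obtain a\<^sub>0 where a0: "a\<^sub>0 \<in> realizations L M {} n q"
    and ramsey: "\<And>b k col. \<lbrakk>set b \<subseteq> univ M; set a\<^sub>0 \<subseteq> set b; definable_coloring L M a\<^sub>0 k col\<rbrakk> \<Longrightarrow>
      \<exists>b' \<in> copies L M (univ M) b. col constant_on copies L M (set b') a\<^sub>0"
    using deerp unfolding type_DEERP_def by blast
  obtain \<phi>s where \<phi>s: "set \<phi>s = D" using D(1) finite_list by blast
  obtain as where as: "set as = R" using R(1) finite_list by blast
  \<comment> \<open>The colored tuple must occur in \<open>b\<close> for DEERP to apply; the tuples
    of \<open>R\<close> are appended so that \<open>g\<close> sends each of them to a copy inside
    \<open>b'\<close>.\<close>
  define b where "b = a\<^sub>0 @ concat as"
  define \<theta> where "\<theta> i = rename (map_sum id c) (\<phi>s ! i)" for i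
  have \<theta>: "\<theta> i \<in> fmlas L ({..<n} <+> univ M)" if "i < length \<phi>s" for i
    unfolding \<theta>_def
    by (rule fmlas_rename[of _ _ "{..<n} <+> UNIV"]) (use that D(2) \<phi>s c in auto)
  define col where
    "col a = (\<lambda>i\<in>{..<length \<phi>s}. if holds M (case_sum (\<lambda>k. a ! k) id) (\<theta> i) then 1 else 0 :: nat)" for a
  have "definable_coloring L M a\<^sub>0 (length \<phi>s) col"
    unfolding definable_coloring_def
  proof (intro conjI exI[of _ \<theta>])
    show "col \<in> copies L M (univ M) a\<^sub>0 \<rightarrow> {..<length \<phi>s} \<rightarrow>\<^sub>E {0, 1}"
      by (auto simp: col_def)
    show "\<forall>i<length \<phi>s. \<theta> i \<in> fmlas L ({..<length a\<^sub>0} <+> univ M)"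
      using \<theta> a0 by (simp add: realizations_def)
  qed (simp add: col_def)
  moreover have "set b \<subseteq> univ M" "set a\<^sub>0 \<subseteq> set b"
    using a0 as R(2) by (auto simp: b_def realizations_def)
  ultimately obtain b' where b': "b' \<in> copies L M (univ M) b"
    and const: "col constant_on copies L M (set b') a\<^sub>0"
    using ramsey by blast
  obtain g where g: "g \<in> Aut L M" "map g b = b'"
    using tuples_conjugate[of b b'] b' \<open>set b \<subseteq> univ M\<close> by (auto simp: copies_def)
  obtain h where h: "h \<in> Aut L M" "\<And>x. x \<in> univ M \<Longrightarrow> g (h x) = x"
    using Aut_inverse[OF struct g(1)] by metis
  have copy: "map g a \<in> copies L M (set b') a\<^sub>0" if "a \<in> R" for a
  proof -
    have "set (map g a) \<subseteq> set b'"
      using that as g(2)[symmetric] by (auto simp: b_def)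
    then show ?thesis
      using tuple_tp_Aut[OF struct g(1), of a] that R(2) a0 by (auto simp: copies_def realizations_def)
  qed
  have col: "holds M (case_sum (h \<circ> c) id) (plug a (\<phi>s ! i)) \<longleftrightarrow> col (map g a) i = 1"
    if a: "a \<in> R" and i: "i < length \<phi>s" for a i
  proof -
    have \<phi>: "\<phi>s ! i \<in> fmlas L ({..<length a} <+> UNIV)"
      using a i D(2) \<phi>s R(2) by (auto simp: realizations_def subset_iff)
    \<comment> \<open>Applying \<open>g\<close> turns \<phi>(a, h c) into \<phi>(g a, c), a color
      bit of \<open>map g a\<close>.\<close>
    have "holds M (case_sum (h \<circ> c) id) (plug a (\<phi>s ! i)) \<longleftrightarrow>
        holds M (case_sum (\<lambda>k. map g a ! k) (g \<circ> (h \<circ> c))) (\<phi>s ! i)"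
      unfolding holds_plug
      by (rule holds_tuple_Aut[OF struct g(1) \<phi>, symmetric])
        (use a R(2) c Aut_in_univ[OF h(1)] in \<open>auto simp: realizations_def\<close>)
    also have "g \<circ> (h \<circ> c) = id \<circ> c" using h(2) c by (auto simp: fun_eq_iff)
    also have "holds M (case_sum (\<lambda>k. map g a ! k) (id \<circ> c)) (\<phi>s ! i) \<longleftrightarrow>
        holds M (case_sum (\<lambda>k. map g a ! k) id) (\<theta> i)"
      by (simp add: \<theta>_def holds_rename_map_sum comp_def)
    finally show ?thesis using i by (simp add: col_def)
  qed
  have "holds M (case_sum (h \<circ> c) id) \<phi>" if "\<phi> \<in> \<Gamma>" for \<phi>
  proof -
    have f: "\<phi> \<in> fmlas L (UNIV <+> {})" and "holds M (case_sum c id) \<phi>"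
      using that \<Gamma> by (auto simp: tp_def)
    then have "holds M (case_sum (h \<circ> c) (h \<circ> id)) \<phi>"
      using holds_case_sum_Aut[OF struct h(1) f, of c id] c by auto
    then show ?thesis
      using holds_case_sum_cong[OF f, of "h \<circ> c" "h \<circ> c" "h \<circ> id" id M] by simp
  qed
  moreover have "holds M (case_sum (h \<circ> c) id) (plug a \<phi>) \<longleftrightarrow> holds M (case_sum (h \<circ> c) id) (plug a' \<phi>)"
    if \<phi>: "\<phi> \<in> D" and a: "a \<in> R" "a' \<in> R" for \<phi> a a'
  proof -
    obtain i where i: "i < length \<phi>s" "\<phi> = \<phi>s ! i" using \<phi> \<phi>s by (metis in_set_conv_nth)
    have "col (map g a) = col (map g a')"
      using const copy a by (auto simp: constant_on_def)
    then show ?thesis using col[OF _ i(1)] a i(2) by simp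
  qed
  moreover have "h \<circ> c \<in> UNIV \<rightarrow> univ M" using c Aut_in_univ[OF h(1)] by auto
  ultimately show "\<exists>v\<in>UNIV \<rightarrow> univ M. (\<forall>\<phi>\<in>\<Gamma>. holds M (case_sum v id) \<phi>) \<and>
        (\<forall>\<phi>\<in>D. \<forall>a\<in>R. \<forall>a'\<in>R. holds M (case_sum v id) (plug a \<phi>) \<longleftrightarrow>
           holds M (case_sum v id) (plug a' \<phi>))"
    by blast
qed

text \<open>The invariant type \<open>p\<close> assigns each copy of \<open>a\<close> the same
  imaginary color. On the finitely many copies inside \<open>b\<close> this is imitated by some
  \<open>g \<circ> c\<close>, and moving \<open>b\<close> back by the inverse of \<open>g\<close>
  turns the imaginary colors into those of the given coloring.\<close>

lemma type_DEERP_if_Inv_q_nonempty: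
  fixes c :: "'i \<Rightarrow> 'm"
  assumes c: "range c = univ M" and q: "q \<in> type_space L M {} {..<n}"
    and nonempty: "Inv_q L M n q c \<noteq> {}"
  shows "type_DEERP L M n q"
proof -
  obtain p where p: "p \<in> S_ext L M c"
    and inv: "\<And>\<phi> a a'. \<lbrakk>\<phi> \<in> fmlas L ({..<n} <+> UNIV); a \<in> realizations L M {} n q;
      a' \<in> realizations L M {} n q\<rbrakk> \<Longrightarrow> plug a \<phi> \<in> p \<longleftrightarrow> plug a' \<phi> \<in> p"
    using nonempty unfolding Inv_q_def by blast
  obtain a where a: "a \<in> realizations L M {} n q"
    using realizations_nonempty[OF _ _ q] by auto
  then have len: "length a = n" by (simp add: realizations_def)
  \<comment> \<open>An index for every element of the model: renaming by \<open>s\<close> replaces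
    the parameters of a coloring formula by variables, and evaluation at \<open>c\<close> restores
    them.\<close>
  obtain s where s: "\<And>x. x \<in> univ M \<Longrightarrow> c (s x) = x"
    using c by (metis f_inv_into_f)
  have "\<exists>b' \<in> copies L M (univ M) b. col constant_on copies L M (set b') a"
    if b: "set b \<subseteq> univ M" and dc: "definable_coloring L M a k col" for b k col
  proof -
    obtain \<phi> where col01: "col \<in> copies L M (univ M) a \<rightarrow> ({..<k} \<rightarrow>\<^sub>E {0, 1})"
      and \<phi>: "\<And>i. i < k \<Longrightarrow> \<phi> i \<in> fmlas L ({..<n} <+> univ M)"
      and col: "\<And>a' i. \<lbrakk>a' \<in> copies L M (univ M) a; i < k\<rbrakk> \<Longrightarrow>
        col a' i = 1 \<longleftrightarrow> holds M (case_sum (\<lambda>k. a' ! k) id) (\<phi> i)"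
      using dc len unfolding definable_coloring_def by blast
    define \<theta> where "\<theta> i = rename (map_sum id s) (\<phi> i)" for i
    have \<theta>: "\<theta> i \<in> fmlas L ({..<n} <+> UNIV)" if "i < k" for i
      unfolding \<theta>_def using \<phi>[OF that] by (rule fmlas_rename) auto
    have copies_real: "a' \<in> realizations L M {} n q" if "a' \<in> copies L M B a" "B \<subseteq> univ M" for a' B
      using that a by (auto simp: copies_def realizations_def)
    \<comment> \<open>Every formula \<open>p\<close> is asked about: one for each copy of
      \<open>a\<close> in \<open>b\<close> and each color bit. There are finitely many copies, as
      \<open>b\<close> is a finite list.\<close>
    define D where "D = (\<lambda>(a', i). plug a' (\<theta> i)) ` (copies L M (set b) a \<times> {..<k})"
    have "finite (copies L M (set b) a)"
      by (rule finite_subset[OF _ finite_lists_length_eq[of "set b" "length a"]])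
        (auto simp: copies_def)
    then have "finite D" by (simp add: D_def)
    moreover have "D \<subseteq> fmlas L (UNIV <+> univ M)"
    proof
      fix \<psi> assume "\<psi> \<in> D"
      then obtain a' i where a': "a' \<in> copies L M (set b) a" and "i < k" "\<psi> = plug a' (\<theta> i)"
        by (auto simp: D_def)
      then show "\<psi> \<in> fmlas L (UNIV <+> univ M)"
        using copies_real[OF a' b] \<theta>[of i] by (auto simp: realizations_def intro: plug_in_fmlas)
    qed
    ultimately obtain g where g: "g \<in> Aut L M"
      and gD: "\<And>\<psi>. \<psi> \<in> D \<Longrightarrow> \<psi> \<in> p \<longleftrightarrow> holds M (case_sum (g \<circ> c) id) \<psi>"
      using S_ext_approx[OF _ p] c by (metis order_refl)
    obtain h where h: "h \<in> Aut L M" "\<And>x. x \<in> univ M \<Longrightarrow> g (h x) = x"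
      using Aut_inverse[OF struct g] by metis
    \<comment> \<open>The homogeneous copy is \<open>map h b\<close>: its copies of \<open>a\<close>
      are sent by \<open>g\<close> to copies inside \<open>b\<close>, where
      \<open>g \<circ> c\<close> agrees with \<open>p\<close>.\<close>
    have hb: "set (map h b) \<subseteq> univ M" using b Aut_in_univ[OF h(1)] by auto
    have back_copy: "map g a' \<in> copies L M (set b) a" if "a' \<in> copies L M (set (map h b)) a" for a'
    proof -
      have "set (map g a') \<subseteq> set b"
        using that h(2) b by (auto simp: copies_def subset_iff)
      moreover have "set a' \<subseteq> univ M" using that hb by (auto simp: copies_def)
      ultimately show ?thesis
        using that tuple_tp_Aut[OF struct g] by (auto simp: copies_def)
    qed
    have color: "col a' i = 1 \<longleftrightarrow> plug (map g a') (\<theta> i) \<in> p"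
      if a': "a' \<in> copies L M (set (map h b)) a" and i: "i < k" for a' i
    proof -
      have a'M: "a' \<in> copies L M (univ M) a" using a' hb by (auto simp: copies_def)
      have len: "length a' = n" "set a' \<subseteq> univ M"
        using copies_real[OF a'M] by (auto simp: realizations_def)
      have "plug (map g a') (\<theta> i) \<in> D"
        using back_copy[OF a'] i by (auto simp: D_def)
      then have "plug (map g a') (\<theta> i) \<in> p \<longleftrightarrow> holds M (case_sum (g \<circ> c) id) (plug (map g a') (\<theta> i))"
        by (rule gD)
      also have "\<dots> \<longleftrightarrow> holds M (case_sum ((\<lambda>k. map g a' ! k) \<circ> id) (g \<circ> c \<circ> s)) (\<phi> i)"
        by (simp only: holds_plug \<theta>_def holds_rename_map_sum)
      also have "\<dots> \<longleftrightarrow> holds M (case_sum (\<lambda>k. map g a' ! k) (g \<circ> id)) (\<phi> i)"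
        by (rule holds_case_sum_cong[OF \<phi>[OF i]]) (auto simp: s)
      also have "\<dots> \<longleftrightarrow> holds M (case_sum (\<lambda>k. a' ! k) id) (\<phi> i)"
        by (rule holds_tuple_Aut[OF struct g, where A = "univ M"]) (use \<phi>[OF i] len in auto)
      finally show ?thesis using col[OF a'M i] by simp
    qed
    have "col a' = col a''"
      if "a' \<in> copies L M (set (map h b)) a" "a'' \<in> copies L M (set (map h b)) a" for a' a''
    proof -
      have M: "a' \<in> copies L M (univ M) a" "a'' \<in> copies L M (univ M) a"
        using that hb by (auto simp: copies_def)
      have real: "map g a' \<in> realizations L M {} n q" "map g a'' \<in> realizations L M {} n q"
        using back_copy that copies_real b by blast+
      show ?thesis
      proof (rule PiE_ext)
        show E: "col a' \<in> {..<k} \<rightarrow>\<^sub>E {0, 1}" "col a'' \<in> {..<k} \<rightarrow>\<^sub>E {0, 1}"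
          using col01 M by blast+
        fix i assume "i \<in> {..<k}"
        then have i: "i < k" by simp
        have "col a' i = 1 \<longleftrightarrow> col a'' i = 1"
          using color[OF that(1) i] color[OF that(2) i] inv[OF \<theta>[OF i] real] by blast
        moreover have "col a' i \<in> {0, 1}" "col a'' i \<in> {0, 1}"
          using E i by (auto simp: PiE_iff)
        ultimately show "col a' i = col a'' i" by auto
      qed
    qed
    then have "col constant_on copies L M (set (map h b)) a"
      unfolding constant_on_def by blast
    moreover have "map h b \<in> copies L M (univ M) b"
      using hb tuple_tp_Aut[OF struct h(1) b] by (simp add: copies_def)
    ultimately show ?thesis by blast
  qed
  then show ?thesis using a unfolding type_DEERP_def by blast
qed

end

section \<open>Invariant types\<close>

lemma finite_support:
  assumes "finite D" "D \<subseteq> fmlas L (V <+> B)"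
  obtains V\<^sub>0 B\<^sub>0 where "finite V\<^sub>0" "finite B\<^sub>0" "B\<^sub>0 \<subseteq> B" "D \<subseteq> fmlas L (V\<^sub>0 <+> B\<^sub>0)"
proof
  define X where "X = (\<Union>\<phi>\<in>D. fm_vars \<phi>)"
  have X: "finite X" using assms(1) by (simp add: X_def finite_fm_vars)
  show "finite (Inl -` X)" "finite (Inr -` X)" using X by (auto intro: finite_vimageI)
  have XV: "X \<subseteq> V <+> B" using assms(2) unfolding X_def fmlas_def by blast
  then show "Inr -` X \<subseteq> B" by auto
  show "D \<subseteq> fmlas L (Inl -` X <+> Inr -` X)"
  proof
    fix \<phi> assume \<phi>: "\<phi> \<in> D"
    have "x \<in> Inl -` X <+> Inr -` X" if "x \<in> X" for x
      using that by (cases x) auto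
    then have "fm_vars \<phi> \<subseteq> Inl -` X <+> Inr -` X" using \<phi> unfolding X_def by blast
    then show "\<phi> \<in> fmlas L (Inl -` X <+> Inr -` X)" using \<phi> assms(2) fmlas_restrict by blast
  qed
qed

lemma rename_Aut_image_subset:
  assumes "D \<subseteq> fmlas L (V <+> univ M)" "G \<subseteq> Aut L M"
  shows "(\<lambda>(\<phi>, g). rename (map_sum id g) \<phi>) ` (D \<times> G) \<subseteq> fmlas L (V <+> univ M)"
proof clarify
  fix \<phi> g assume "\<phi> \<in> D" "g \<in> G"
  then show "rename (map_sum id g) \<phi> \<in> fmlas L (V <+> univ M)"
    using assms by (intro rename_Aut_in_fmlas) auto
qed

lemma rename_Aut_plug:
  assumes "\<phi> \<in> fmlas L ({..<length a} <+> UNIV)"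
  shows "rename (map_sum id g) (plug a \<phi>) = plug (map g a) \<phi>"
  unfolding plug_def rename_rename
  by (rule rename_cong) (auto dest!: fmlas_vars[OF assms])

text \<open>Parameters from \<open>b\<close> become variables naming a chosen position in
  \<open>b\<close>. Statements about arbitrary formulas with parameters thereby reduce to statements
  about the type of \<open>b\<close>.\<close>

lemma plug_surj:
  assumes "\<phi> \<in> fmlas L (UNIV <+> set b)"
  obtains \<psi> where "\<psi> \<in> fmlas L ({..<length b} <+> UNIV)" "\<phi> = plug b \<psi>"
proof
  define idx where "idx x = (SOME k. k < length b \<and> b ! k = x)" for x
  have idx: "idx x < length b \<and> b ! idx x = x" if "x \<in> set b" for x
    unfolding idx_def by (rule someI_ex) (use that in \<open>auto simp: in_set_conv_nth\<close>)
  define \<psi> where "\<psi> = rename (case_sum Inr (\<lambda>x. Inl (idx x))) \<phi>"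
  show "\<psi> \<in> fmlas L ({..<length b} <+> UNIV)"
    unfolding \<psi>_def using assms by (rule fmlas_rename) (use idx in auto)
  show "\<phi> = plug b \<psi>"
    unfolding \<psi>_def plug_def rename_rename
    by (rule rename_idem[symmetric]) (use fmlas_vars[OF assms] idx in \<open>auto split: sum.split\<close>)
qed

text \<open>Reindexing acts on the variables and an automorphism on the parameters, the two sides of
  the disjoint sum. This is why invariance passes to reindexed types.\<close>

lemma rename_commute:
  "rename (map_sum id g) (rename (map_sum s id) \<phi>) = rename (map_sum s id) (rename (map_sum id g) \<phi>)"
  unfolding rename_rename map_sum.comp by simp

context homogeneous_struct
begin

text \<open>Two realizations of \<open>q\<close> are conjugate by homogeneity, and the automorphism
  \<open>g\<close> carrying \<open>a\<close> to \<open>a'\<close> carries \<phi>(a, y) to \<phi>(a',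
  y).\<close>

lemma Inv_subset_Inv_q: "Inv L M c \<subseteq> Inv_q L M n q c"
proof
  fix p assume "p \<in> Inv L M c"
  then have p: "p \<in> S_ext L M c" and inv: "\<And>g. g \<in> Aut L M \<Longrightarrow> act g p = p"
    by (auto simp: Inv_def)
  have "plug a \<phi> \<in> p \<longleftrightarrow> plug a' \<phi> \<in> p"
    if \<phi>: "\<phi> \<in> fmlas L ({..<n} <+> UNIV)" and a: "a \<in> realizations L M {} n q"
      and a': "a' \<in> realizations L M {} n q" for \<phi> a a'
  proof -
    obtain g where g: "g \<in> Aut L M" "map g a = a'"
      using tuples_conjugate[of a a'] a a' by (auto simp: realizations_def)
    have \<phi>': "\<phi> \<in> fmlas L ({..<length a} <+> UNIV)" "set a \<subseteq> univ M"
      using \<phi> a by (auto simp: realizations_def)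
    then have "plug a \<phi> \<in> fmlas L (UNIV <+> univ M)" by (rule plug_in_fmlas)
    then have "plug a \<phi> \<in> p \<longleftrightarrow> rename (map_sum id g) (plug a \<phi>) \<in> p"
      using act_eq_iff[OF struct g(1) S_ext_type_space[OF p]] inv[OF g(1)] by blast
    then show ?thesis unfolding rename_Aut_plug[OF \<phi>'(1)] g(2) .
  qed
  then show "p \<in> Inv_q L M n q c" using p unfolding Inv_q_def by blast
qed

lemma Inv_nonempty_iff:
  fixes c :: "'i \<Rightarrow> 'm"
  shows "Inv L M c \<noteq> {} \<longleftrightarrow> (\<exists>p \<in> type_space L M (univ M) UNIV.
    tp L M {} UNIV c \<subseteq> p \<and> (\<forall>g\<in>Aut L M. act g p = p))"
  by (auto simp: Inv_def S_ext_def)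

text \<open>
  Finitely many conditions \<open>\<phi>\<^sub>i \<leftrightarrow> g\<^sub>i \<phi>\<^sub>i\<close> involve different types of parameters. They all follow from
  invariance for the single type of a tuple \<open>b\<close> listing every parameter of every \<open>\<phi>\<^sub>i\<close>, because
  \<open>g\<^sub>i b\<close> has the same type as \<open>b\<close>.
\<close>

lemma Inv_nonempty_if_Inv_q_nonempty:
  fixes c :: "'i \<Rightarrow> 'm"
  assumes "\<And>n q. q \<in> type_space L M {} {..<n} \<Longrightarrow> Inv_q L M n q c \<noteq> {}"
  shows "Inv L M c \<noteq> {}"
  unfolding Inv_nonempty_iff
proof (rule invariant_type_exists[OF struct])
  show \<Gamma>: "tp L M {} UNIV c \<subseteq> fmlas L (UNIV <+> univ M)"
    by (auto simp: tp_def intro: fmlas_mono)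
  fix \<Gamma>\<^sub>0 D :: "('f, 'r, 'i + 'm) fm set" and G
  assume \<Gamma>0: "finite \<Gamma>\<^sub>0" "\<Gamma>\<^sub>0 \<subseteq> tp L M {} UNIV c"
    and D: "finite D" "D \<subseteq> fmlas L (UNIV <+> univ M)" and G: "finite G" "G \<subseteq> Aut L M"
  obtain V B where B: "finite B" "B \<subseteq> univ M" "D \<subseteq> fmlas L (V <+> B)"
    using finite_support[OF D] by metis
  obtain b where b: "set b = B" using B(1) finite_list by blast
  have bM: "set b \<subseteq> univ M" using b B(2) by simp
  define q where "q = tuple_tp L M {} b"
  obtain p where p: "p \<in> Inv_q L M (length b) q c"
    using assms[of q "length b"] tuple_tp_in_type_space[OF bM] unfolding q_def by blast
  then have pS: "p \<in> S_ext L M c" by (simp add: Inv_q_def)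
  \<comment> \<open>The renamed formulas may use parameters outside \<open>b\<close>, so agreement
    of \<open>v\<close> with \<open>p\<close> on them has to be requested separately.\<close>
  define D' where "D' = \<Gamma>\<^sub>0 \<union> D \<union> (\<lambda>(\<phi>, g). rename (map_sum id g) \<phi>) ` (D \<times> G)"
  have "finite D'" using \<Gamma>0 D G by (simp add: D'_def)
  moreover have "D' \<subseteq> fmlas L (UNIV <+> univ M)"
    unfolding D'_def using \<Gamma>0(2) \<Gamma> D(2) rename_Aut_image_subset[OF D(2) G(2)] by blast
  ultimately obtain v where v: "v \<in> UNIV \<rightarrow> univ M"
    "\<And>\<phi>. \<phi> \<in> D' \<Longrightarrow> \<phi> \<in> p \<longleftrightarrow> holds M (case_sum v id) \<phi>"
    using type_space_approx[OF S_ext_type_space[OF pS]] by metis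
  have "holds M (case_sum v id) \<phi>" if "\<phi> \<in> \<Gamma>\<^sub>0" for \<phi>
    using v(2)[of \<phi>] that \<Gamma>0(2) pS by (auto simp: D'_def S_ext_def)
  moreover have "holds M (case_sum v id) \<phi> \<longleftrightarrow> holds M (case_sum v id) (rename (map_sum id g) \<phi>)"
    if \<phi>: "\<phi> \<in> D" and g: "g \<in> G" for \<phi> g
  proof -
    have "\<phi> \<in> fmlas L (UNIV <+> set b)"
      using \<phi> B(3) b by (auto intro: fmlas_mono)
    then obtain \<psi> where \<psi>: "\<psi> \<in> fmlas L ({..<length b} <+> UNIV)" "\<phi> = plug b \<psi>"
      by (rule plug_surj)
    have gA: "g \<in> Aut L M" using g G(2) by blast
    have "b \<in> realizations L M {} (length b) q" "map g b \<in> realizations L M {} (length b) q"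
      using bM tuple_tp_Aut[OF struct gA bM] Aut_in_univ[OF gA]
      by (auto simp: realizations_def q_def)
    then have "plug b \<psi> \<in> p \<longleftrightarrow> plug (map g b) \<psi> \<in> p"
      using p \<psi>(1) unfolding Inv_q_def by blast
    then have "\<phi> \<in> p \<longleftrightarrow> rename (map_sum id g) \<phi> \<in> p"
      unfolding \<psi>(2) rename_Aut_plug[OF \<psi>(1)] .
    moreover have "\<phi> \<in> D'" "rename (map_sum id g) \<phi> \<in> D'"
      using \<phi> g by (auto simp: D'_def)
    ultimately show ?thesis using v(2) by blast
  qed
  ultimately show "\<exists>v\<in>UNIV \<rightarrow> univ M. (\<forall>\<phi>\<in>\<Gamma>\<^sub>0. holds M (case_sum v id) \<phi>) \<and>
      (\<forall>\<phi>\<in>D. \<forall>g\<in>G. holds M (case_sum v id) \<phi> \<longleftrightarrow>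
         holds M (case_sum v id) (rename (map_sum id g) \<phi>))"
    using v(1) by blast
qed

text \<open>A finite part of the given type is realized by some \<open>w\<close>, and
  \<open>w\<close> is a reindexing of \<open>c\<close> on \<open>V\<close> since \<open>c\<close>
  lists all elements. The same reindexing of \<open>p\<close> is invariant and contains that finite
  part. As the reindexing depends on the part, compactness is needed once more.\<close>

lemma extremely_amenable_if_Inv_nonempty:
  fixes c :: "'i \<Rightarrow> 'm"
  assumes c: "range c = univ M" and nonempty: "Inv L M c \<noteq> {}"
  shows "extremely_amenable TYPE('v) L M"
  unfolding extremely_amenable_def
proof (intro allI ballI)
  fix V :: "'v set" and p\<^sub>0 assume p0: "p\<^sub>0 \<in> type_space L M {} V"
  obtain p where p: "p \<in> S_ext L M c" and inv: "\<And>g. g \<in> Aut L M \<Longrightarrow> act g p = p"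
    using nonempty by (auto simp: Inv_def)
  show "\<exists>r \<in> type_space L M (univ M) V. p\<^sub>0 \<subseteq> r \<and> (\<forall>g\<in>Aut L M. act g r = r)"
  proof (rule invariant_type_exists[OF struct])
    show "p\<^sub>0 \<subseteq> fmlas L (V <+> univ M)"
      using type_space_fmlas[OF p0] by (auto intro: fmlas_mono)
    fix \<Gamma>\<^sub>0 D G assume \<Gamma>0: "finite \<Gamma>\<^sub>0" "\<Gamma>\<^sub>0 \<subseteq> p\<^sub>0"
      and D: "finite D" "D \<subseteq> fmlas L (V <+> univ M)" and G: "finite G" "G \<subseteq> Aut L M"
    obtain w where w: "w \<in> V \<rightarrow> univ M" "\<forall>\<phi>\<in>\<Gamma>\<^sub>0. holds M (case_sum w id) \<phi>"
      using type_space_satisfiable[OF p0 \<Gamma>0] by blast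
    \<comment> \<open>Selects for each variable a coordinate of \<open>c\<close> holding the value
      of \<open>w\<close>; only variables in \<open>V\<close> have a prescribed value.\<close>
    define s where "s x = inv_into UNIV c (w x)" for x
    have s: "c (s x) = w x" if "x \<in> V" for x
      using w(1) c that by (auto simp: s_def intro!: f_inv_into_f)
    define \<rho> where "\<rho> \<phi> = rename (map_sum s id) \<phi>" for \<phi> :: "('f, 'r, 'v + 'm) fm"
    have \<rho>_fmlas: "\<rho> \<phi> \<in> fmlas L (UNIV <+> A)" if "\<phi> \<in> fmlas L (V <+> A)" for \<phi> A
      unfolding \<rho>_def using that by (rule fmlas_rename) auto
    define D' where "D' = \<Gamma>\<^sub>0 \<union> D \<union> (\<lambda>(\<phi>, g). rename (map_sum id g) \<phi>) ` (D \<times> G)"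
    have "D' \<subseteq> fmlas L (V <+> univ M)"
      unfolding D'_def
      using \<Gamma>0(2) D(2) \<open>p\<^sub>0 \<subseteq> fmlas L (V <+> univ M)\<close> rename_Aut_image_subset[OF D(2) G(2)] by blast
    moreover have "finite D'" using \<Gamma>0 D G by (simp add: D'_def)
    ultimately have D': "finite D'" "D' \<subseteq> fmlas L (V <+> univ M)" by auto
    have "finite (\<rho> ` D')" "\<rho> ` D' \<subseteq> fmlas L (UNIV <+> univ M)"
      using D' \<rho>_fmlas by auto
    then obtain v where v: "v \<in> UNIV \<rightarrow> univ M"
      "\<And>\<phi>. \<phi> \<in> \<rho> ` D' \<Longrightarrow> \<phi> \<in> p \<longleftrightarrow> holds M (case_sum v id) \<phi>"
      using type_space_approx[OF S_ext_type_space[OF p]] by metis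
    have holds_v: "holds M (case_sum (v \<circ> s) id) \<phi> \<longleftrightarrow> \<rho> \<phi> \<in> p" if "\<phi> \<in> D'" for \<phi>
      using v(2)[of "\<rho> \<phi>"] that by (simp add: \<rho>_def holds_rename_map_sum del: o_apply)
    have "holds M (case_sum (v \<circ> s) id) \<phi>" if \<phi>: "\<phi> \<in> \<Gamma>\<^sub>0" for \<phi>
    proof -
      have f: "\<phi> \<in> fmlas L (V <+> {})" using \<phi> \<Gamma>0(2) type_space_fmlas[OF p0] by blast
      have "holds M (case_sum (c \<circ> s) (id \<circ> id)) \<phi> \<longleftrightarrow> holds M (case_sum w id) \<phi>"
        by (rule holds_case_sum_cong[OF f]) (auto simp: s)
      then have "holds M (case_sum c id) (\<rho> \<phi>)"
        using w(2) \<phi> unfolding \<rho>_def holds_rename_map_sum by blast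
      then have "\<rho> \<phi> \<in> p" using S_ext_tp_iff[OF p \<rho>_fmlas[OF f]] by blast
      then show ?thesis using holds_v[of \<phi>] \<phi> by (simp add: D'_def del: o_apply)
    qed
    moreover have "holds M (case_sum (v \<circ> s) id) \<phi> \<longleftrightarrow>
        holds M (case_sum (v \<circ> s) id) (rename (map_sum id g) \<phi>)" if \<phi>: "\<phi> \<in> D" and g: "g \<in> G" for \<phi> g
    proof -
      have gA: "g \<in> Aut L M" using g G(2) by blast
      have "\<rho> \<phi> \<in> fmlas L (UNIV <+> univ M)" using \<phi> D(2) \<rho>_fmlas by blast
      then have "\<rho> \<phi> \<in> p \<longleftrightarrow> rename (map_sum id g) (\<rho> \<phi>) \<in> p"
        using act_eq_iff[OF struct gA S_ext_type_space[OF p]] inv[OF gA] by blast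
      then have "\<rho> \<phi> \<in> p \<longleftrightarrow> \<rho> (rename (map_sum id g) \<phi>) \<in> p"
        unfolding \<rho>_def rename_commute .
      moreover have "\<phi> \<in> D'" "rename (map_sum id g) \<phi> \<in> D'"
        using \<phi> g by (auto simp: D'_def)
      ultimately show ?thesis using holds_v by blast
    qed
    moreover have "v \<circ> s \<in> V \<rightarrow> univ M" using v(1) by auto
    ultimately show "\<exists>v\<in>V \<rightarrow> univ M. (\<forall>\<phi>\<in>\<Gamma>\<^sub>0. holds M (case_sum v id) \<phi>) \<and>
        (\<forall>\<phi>\<in>D. \<forall>g\<in>G. holds M (case_sum v id) \<phi> \<longleftrightarrow>
           holds M (case_sum v id) (rename (map_sum id g) \<phi>))"
      by blast
  qed
qed

text \<open>The obstacle is that \<open>'v\<close> may be too small to index \<open>c\<close>. A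
  finite approximation mentions only a finite set \<open>I\<close> of coordinates, however, and
  \<open>I\<close> embeds into the infinite type \<open>'v\<close>; amenability is applied to the
  type of that finite piece of \<open>c\<close>.\<close>

lemma Inv_nonempty_if_extremely_amenable:
  fixes c :: "'i \<Rightarrow> 'm"
  assumes c: "range c \<subseteq> univ M" and infinite: "infinite (UNIV :: 'v set)"
    and amenable: "extremely_amenable TYPE('v) L M"
  shows "Inv L M c \<noteq> {}"
  unfolding Inv_nonempty_iff
proof (rule invariant_type_exists[OF struct])
  show \<Gamma>: "tp L M {} UNIV c \<subseteq> fmlas L (UNIV <+> univ M)"
    by (auto simp: tp_def intro: fmlas_mono)
  fix \<Gamma>\<^sub>0 D :: "('f, 'r, 'i + 'm) fm set" and G
  assume \<Gamma>0: "finite \<Gamma>\<^sub>0" "\<Gamma>\<^sub>0 \<subseteq> tp L M {} UNIV c"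
    and D: "finite D" "D \<subseteq> fmlas L (UNIV <+> univ M)" and G: "finite G" "G \<subseteq> Aut L M"
  have "finite (\<Gamma>\<^sub>0 \<union> D)" "\<Gamma>\<^sub>0 \<union> D \<subseteq> fmlas L (UNIV <+> univ M)"
    using \<Gamma>0 \<Gamma> D by auto
  then obtain I B where I: "finite I" "B \<subseteq> univ M" "\<Gamma>\<^sub>0 \<union> D \<subseteq> fmlas L (I <+> B)"
    using finite_support by metis
  obtain V :: "'v set" where "finite V" "card V = card I"
    using infinite_arbitrarily_large[OF infinite] by blast
  then obtain s where s: "bij_betw s I V"
    using I(1) finite_same_card_bij by metis
  \<comment> \<open>The piece of \<open>c\<close> indexed by \<open>I\<close>, carried over to
    \<open>V\<close>. Off \<open>V\<close> the value is some entry of \<open>c\<close>.\<close>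
  define u where "u x = c (inv_into I s x)" for x
  have us: "u (s i) = c i" if "i \<in> I" for i
    using s that by (simp add: u_def bij_betw_inv_into_left)
  have "tp L M {} V u \<in> type_space L M {} V"
    by (rule tp_in_type_space) (use c in \<open>auto simp: u_def\<close>)
  then obtain r where r: "r \<in> type_space L M (univ M) V" "tp L M {} V u \<subseteq> r"
    and inv: "\<And>g. g \<in> Aut L M \<Longrightarrow> act g r = r"
    using amenable unfolding extremely_amenable_def by meson
  define \<rho> where "\<rho> \<phi> = rename (map_sum s id) \<phi>" for \<phi> :: "('f, 'r, 'i + 'm) fm"
  have \<rho>_fmlas: "\<rho> \<phi> \<in> fmlas L (V <+> A)" if "\<phi> \<in> fmlas L (I <+> A)" for \<phi> A
    unfolding \<rho>_def using that by (rule fmlas_rename) (use s in \<open>auto simp: bij_betw_def\<close>)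
  define D' where "D' = \<Gamma>\<^sub>0 \<union> D \<union> (\<lambda>(\<phi>, g). rename (map_sum id g) \<phi>) ` (D \<times> G)"
  have base: "\<Gamma>\<^sub>0 \<union> D \<subseteq> fmlas L (I <+> univ M)"
    using I(2,3) by (auto intro!: fmlas_mono[of _ L "I <+> B" "I <+> univ M"])
  have "D \<subseteq> fmlas L (I <+> univ M)" using base by blast
  then have "D' \<subseteq> fmlas L (I <+> univ M)"
    unfolding D'_def using base rename_Aut_image_subset[OF _ G(2)] by (metis Un_least)
  moreover have "finite D'" using \<Gamma>0 D G by (simp add: D'_def)
  ultimately have D': "finite D'" "D' \<subseteq> fmlas L (I <+> univ M)" by auto
  have "finite (\<rho> ` D')" "\<rho> ` D' \<subseteq> fmlas L (V <+> univ M)"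
    using D' \<rho>_fmlas by auto
  then obtain v where v: "v \<in> V \<rightarrow> univ M"
    "\<And>\<phi>. \<phi> \<in> \<rho> ` D' \<Longrightarrow> \<phi> \<in> r \<longleftrightarrow> holds M (case_sum v id) \<phi>"
    using type_space_approx[OF r(1)] by metis
  \<comment> \<open>Coordinates outside \<open>I\<close> do not occur in \<open>D'\<close>;
    \<open>c i\<close> is a default that lies in the universe.\<close>
  define v' where "v' i = (if i \<in> I then v (s i) else c i)" for i
  have holds_v: "holds M (case_sum v' id) \<phi> \<longleftrightarrow> \<rho> \<phi> \<in> r" if \<phi>: "\<phi> \<in> D'" for \<phi>
  proof -
    have f: "\<phi> \<in> fmlas L (I <+> univ M)" using \<phi> D'(2) by blast
    have "holds M (case_sum v' id) \<phi> \<longleftrightarrow> holds M (case_sum (v \<circ> s) (id \<circ> id)) \<phi>"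
      by (rule holds_case_sum_cong[OF f]) (auto simp: v'_def)
    then show ?thesis
      using v(2)[of "\<rho> \<phi>"] \<phi> unfolding \<rho>_def holds_rename_map_sum by blast
  qed
  have "holds M (case_sum v' id) \<phi>" if \<phi>: "\<phi> \<in> \<Gamma>\<^sub>0" for \<phi>
  proof -
    have "\<phi> \<in> fmlas L (UNIV <+> {})" "holds M (case_sum c id) \<phi>"
      using \<phi> \<Gamma>0(2) by (auto simp: tp_def)
    moreover from this have f: "\<phi> \<in> fmlas L (I <+> {})"
      using \<phi> base unfolding fmlas_def by blast
    moreover have "holds M (case_sum (u \<circ> s) (id \<circ> id)) \<phi> \<longleftrightarrow> holds M (case_sum c id) \<phi>"
      by (rule holds_case_sum_cong[OF f]) (auto simp: us)
    ultimately have "holds M (case_sum u id) (\<rho> \<phi>)"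
      unfolding \<rho>_def holds_rename_map_sum by blast
    then have "\<rho> \<phi> \<in> r" using r(2) \<rho>_fmlas[OF f] by (auto simp: tp_def)
    then show ?thesis using holds_v[of \<phi>] \<phi> by (simp add: D'_def)
  qed
  moreover have "holds M (case_sum v' id) \<phi> \<longleftrightarrow>
      holds M (case_sum v' id) (rename (map_sum id g) \<phi>)" if \<phi>: "\<phi> \<in> D" and g: "g \<in> G" for \<phi> g
  proof -
    have gA: "g \<in> Aut L M" using g G(2) by blast
    have "\<rho> \<phi> \<in> fmlas L (V <+> univ M)" using \<phi> base \<rho>_fmlas by blast
    then have "\<rho> \<phi> \<in> r \<longleftrightarrow> rename (map_sum id g) (\<rho> \<phi>) \<in> r"
      using act_eq_iff[OF struct gA r(1)] inv[OF gA] by blast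
    then have "\<rho> \<phi> \<in> r \<longleftrightarrow> \<rho> (rename (map_sum id g) \<phi>) \<in> r"
      unfolding \<rho>_def rename_commute .
    moreover have "\<phi> \<in> D'" "rename (map_sum id g) \<phi> \<in> D'"
      using \<phi> g by (auto simp: D'_def)
    ultimately show ?thesis using holds_v by blast
  qed
  moreover have "v' \<in> UNIV \<rightarrow> univ M"
    using v(1) s c by (auto simp: v'_def Pi_iff bij_betw_def)
  ultimately show "\<exists>v\<in>UNIV \<rightarrow> univ M. (\<forall>\<phi>\<in>\<Gamma>\<^sub>0. holds M (case_sum v id) \<phi>) \<and>
      (\<forall>\<phi>\<in>D. \<forall>g\<in>G. holds M (case_sum v id) \<phi> \<longleftrightarrow>
         holds M (case_sum v id) (rename (map_sum id g) \<phi>))"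
    by blast
qed

end

section \<open>The Ellis semigroup\<close>

text \<open>Alexander's subbase theorem concerns \<open>Y\<close>, the topology of unions of finite
  intersections. Every open set of the generated topology is open in \<open>Y\<close> and the points
  are the same, so compactness carries over.\<close>

lemma compact_space_topology_generated_by:
  assumes "\<And>\<C>. \<lbrakk>\<C> \<subseteq> \<B>; \<Union>\<C> = \<Union>\<B>\<rbrakk> \<Longrightarrow> \<exists>\<C>'. finite \<C>' \<and> \<C>' \<subseteq> \<C> \<and> \<Union>\<C>' = \<Union>\<B>"
  shows "compact_space (topology_generated_by \<B>)"
proof -
  define Y where "Y = topology (arbitrary union_of (finite intersection_of (\<lambda>x. x \<in> \<B>) relative_to \<Union>\<B>))"
  have top: "topspace Y = \<Union>\<B>" by (simp add: Y_def)
  have "compact_space Y"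
    by (rule Alexander_subbase[of \<B>]) (use assms top in \<open>auto simp: Y_def[symmetric]\<close>)
  moreover have basis: "openin Y S" if "S \<in> \<B>" for S
  proof -
    have "(finite intersection_of (\<lambda>x. x \<in> \<B>) relative_to \<Union>\<B>) (\<Union>\<B> \<inter> S)"
      using that by (intro relative_to_inc finite_intersection_of_inc)
    moreover have "\<Union>\<B> \<inter> S = S" using that by blast
    ultimately show ?thesis
      unfolding Y_def openin_subbase by (metis arbitrary_union_of_inc)
  qed
  have "openin Y S" if "openin (topology_generated_by \<B>) S" for S
    using generate_topology_on_coarsest[OF istopology_openin basis] openin_topology_generated_by[OF that]
    by blast
  ultimately show ?thesis
    unfolding compact_space_alt top topology_generated_by_topspace by metis
qed

lemma topspace_S_ext_topology [simp]:
  fixes L :: "('f, 'r) language" and c :: "'i \<Rightarrow> 'm"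
  shows "topspace (S_ext_topology L M c) = S_ext L M c"
proof -
  \<comment> \<open>A sentence available in every language. Each type contains it or its negation,
    so two basic open sets already cover the space.\<close>
  define \<theta> :: "('f, 'r, 'i + 'm) fm" where "\<theta> = Ex (Eq (Bnd 0) (Bnd 0))"
  have \<theta>: "\<theta> \<in> fmlas L (UNIV <+> univ M)" by (simp add: \<theta>_def fmlas_def)
  have "\<theta> \<in> p \<or> Neg \<theta> \<in> p" if "p \<in> S_ext L M c" for p
    using that \<theta> by (auto simp: S_ext_def type_space_def)
  moreover have "Neg \<theta> \<in> fmlas L (UNIV <+> univ M)" using \<theta> by simp
  ultimately show ?thesis using \<theta>
    unfolding S_ext_topology_def topology_generated_by_topspace by blast
qed

lemma openin_S_ext_topology:
  "\<phi> \<in> fmlas L (UNIV <+> univ M) \<Longrightarrow> openin (S_ext_topology L M c) {p \<in> S_ext L M c. \<phi> \<in> p}"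
  unfolding S_ext_topology_def by (rule topology_generated_by_Basis) blast

lemma closedin_S_ext_topology:
  assumes "\<phi> \<in> fmlas L (UNIV <+> univ M)"
  shows "closedin (S_ext_topology L M c) {p \<in> S_ext L M c. \<phi> \<in> p}"
proof -
  have "S_ext L M c - {p \<in> S_ext L M c. \<phi> \<in> p} = {p \<in> S_ext L M c. Neg \<phi> \<in> p}"
    using type_space_Neg[OF S_ext_type_space assms] by blast
  then show ?thesis
    using openin_S_ext_topology[of "Neg \<phi>" L M c] assms by (auto simp: closedin_def)
qed

text \<open>If the basic sets of \<open>\<Phi>\<close> cover, the type of \<open>c\<close> together
  with the negations of \<open>\<Phi>\<close> has no completion. By \<open>Lindenbaum\<close> some
  finite part is unsatisfiable, and the negations in it name a finite subcover.\<close>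

lemma compact_space_S_ext_topology:
  fixes c :: "'i \<Rightarrow> 'm"
  shows "compact_space (S_ext_topology L M c)"
  unfolding S_ext_topology_def
proof (rule compact_space_topology_generated_by)
  define B where "B \<phi> = {p \<in> S_ext L M c. \<phi> \<in> p}" for \<phi>
  have Un: "\<Union> {{p \<in> S_ext L M c. \<phi> \<in> p} |\<phi>. \<phi> \<in> fmlas L (UNIV <+> univ M)} = S_ext L M c"
    using topspace_S_ext_topology[of L M c]
    unfolding S_ext_topology_def topology_generated_by_topspace .
  fix \<C> assume "\<C> \<subseteq> {{p \<in> S_ext L M c. \<phi> \<in> p} |\<phi>. \<phi> \<in> fmlas L (UNIV <+> univ M)}"
    and "\<Union>\<C> = \<Union> {{p \<in> S_ext L M c. \<phi> \<in> p} |\<phi>. \<phi> \<in> fmlas L (UNIV <+> univ M)}"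
  then have "\<C> \<subseteq> B ` fmlas L (UNIV <+> univ M)" and cover: "\<Union>\<C> = S_ext L M c"
    unfolding Un by (auto simp: B_def)
  then obtain \<Phi> where \<Phi>: "\<Phi> \<subseteq> fmlas L (UNIV <+> univ M)" "\<C> = B ` \<Phi>"
    by (meson subset_imageE)
  define \<Gamma> where "\<Gamma> = tp L M {} UNIV c \<union> Neg ` \<Phi>"
  have \<Gamma>: "\<Gamma> \<subseteq> fmlas L (UNIV <+> univ M)"
    using \<Phi>(1) by (auto simp: \<Gamma>_def tp_def intro: fmlas_mono)
  have "\<not> finitely_satisfiable M UNIV \<Gamma>"
  proof
    assume "finitely_satisfiable M UNIV \<Gamma>"
    then obtain p where p: "p \<in> type_space L M (univ M) UNIV" "\<Gamma> \<subseteq> p"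
      using Lindenbaum[OF \<Gamma>] by metis
    then have "p \<in> \<Union>\<C>" using cover by (auto simp: S_ext_def \<Gamma>_def)
    then obtain \<phi> where "\<phi> \<in> \<Phi>" "\<phi> \<in> p" by (auto simp: \<Phi>(2) B_def)
    then show False using type_space_Neg[OF p(1), of \<phi>] p(2) \<Phi>(1) by (auto simp: \<Gamma>_def)
  qed
  then obtain F where F: "finite F" "F \<subseteq> \<Gamma>"
    "\<not> (\<exists>v\<in>UNIV \<rightarrow> univ M. \<forall>\<phi>\<in>F. holds M (case_sum v id) \<phi>)"
    unfolding finitely_satisfiable_def by blast
  then obtain \<Phi>\<^sub>0 where \<Phi>0: "\<Phi>\<^sub>0 \<subseteq> \<Phi>" "finite \<Phi>\<^sub>0" "F - tp L M {} UNIV c = Neg ` \<Phi>\<^sub>0"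
    using finite_subset_image[of "F - tp L M {} UNIV c" Neg \<Phi>] unfolding \<Gamma>_def by blast
  have "p \<in> \<Union> (B ` \<Phi>\<^sub>0)" if p: "p \<in> S_ext L M c" for p
  proof (rule ccontr)
    assume "p \<notin> \<Union> (B ` \<Phi>\<^sub>0)"
    then have "Neg \<phi> \<in> p" if "\<phi> \<in> \<Phi>\<^sub>0" for \<phi>
      using type_space_Neg[OF S_ext_type_space[OF p], of \<phi>] that \<Phi>0(1) \<Phi>(1) p by (auto simp: B_def)
    then have "Neg ` \<Phi>\<^sub>0 \<subseteq> p" by blast
    then have "F \<subseteq> p" using \<Phi>0(3) p unfolding S_ext_def by blast
    then show False using type_space_satisfiable[OF S_ext_type_space[OF p] F(1)] F(3) by metis
  qed
  then have "\<Union> (B ` \<Phi>\<^sub>0) = S_ext L M c" by (auto simp: B_def)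
  then show "\<exists>\<C>'. finite \<C>' \<and> \<C>' \<subseteq> \<C> \<and>
      \<Union>\<C>' = \<Union> {{p \<in> S_ext L M c. \<phi> \<in> p} |\<phi>. \<phi> \<in> fmlas L (UNIV <+> univ M)}"
    unfolding Un \<Phi>(2) using \<Phi>0(1,2) by (intro exI[of _ "B ` \<Phi>\<^sub>0"]) auto
qed

lemma tp_in_S_ext:
  assumes "range c' \<subseteq> univ M" "tp L M {} UNIV c' = tp L M {} UNIV c"
  shows "tp L M (univ M) UNIV c' \<in> S_ext L M c"
proof -
  have "tp L M {} UNIV c' \<subseteq> tp L M (univ M) UNIV c'"
    by (auto simp: tp_def intro: fmlas_mono)
  then show ?thesis
    using tp_in_type_space[of c' UNIV M L "univ M"] assms by (simp add: S_ext_def)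
qed

section \<open>Limits of automorphisms in the space of maps\<close>

abbreviation S_ext_maps :: "('f, 'r) language \<Rightarrow> ('f, 'r, 'm) struct \<Rightarrow> ('i \<Rightarrow> 'm) \<Rightarrow>
    (('f, 'r, 'i + 'm) fm set \<Rightarrow> ('f, 'r, 'i + 'm) fm set) topology" where
  "S_ext_maps L M c \<equiv> product_topology (\<lambda>_. S_ext_topology L M c) (S_ext L M c)"

lemma EL_eq:
  "EL L M c = S_ext_maps L M c closure_of ((\<lambda>g. restrict (act g) (S_ext L M c)) ` Aut L M)"
  by (simp add: EL_def ellis_semigroup_def)

lemma EL_maps_S_ext: "\<eta> \<in> EL L M c \<Longrightarrow> r \<in> S_ext L M c \<Longrightarrow> \<eta> r \<in> S_ext L M c"
  using closure_of_subset_topspace unfolding EL_eq by (fastforce simp: PiE_iff)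

text \<open>Evaluation at \<open>r\<close> is continuous. Closedness serves the finite intersection
  property in \<open>EL_attains\<close>; with openness, agreement of two such conditions is closed
  as well, as \<open>EL_reindex\<close> requires.\<close>

lemma S_ext_maps_clopen:
  assumes "r \<in> S_ext L M c" "\<phi> \<in> fmlas L (UNIV <+> univ M)"
  defines "K \<equiv> {\<eta> \<in> topspace (S_ext_maps L M c). \<phi> \<in> \<eta> r}"
  shows "closedin (S_ext_maps L M c) K" "openin (S_ext_maps L M c) K"
proof -
  have K: "K = {\<eta> \<in> topspace (S_ext_maps L M c). \<eta> r \<in> {p \<in> S_ext L M c. \<phi> \<in> p}}"
    using assms(1) by (auto simp: K_def PiE_iff)
  have cont: "continuous_map (S_ext_maps L M c) (S_ext_topology L M c) (\<lambda>\<eta>. \<eta> r)"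
    using assms(1) by (rule continuous_map_product_projection)
  show "closedin (S_ext_maps L M c) K"
    unfolding K by (rule closedin_continuous_map_preimage[OF cont closedin_S_ext_topology[OF assms(2)]])
  show "openin (S_ext_maps L M c) K"
    unfolding K by (rule openin_continuous_map_preimage[OF cont openin_S_ext_topology[OF assms(2)]])
qed

context homogeneous_struct
begin

lemma orbit_subset_topspace:
  "(\<lambda>g. restrict (act g) (S_ext L M c)) ` Aut L M \<subseteq> topspace (S_ext_maps L M c)"
  using act_in_S_ext[OF struct] by auto

text \<open>The closed sets \<open>K \<phi>\<close> for \<phi> in \<open>p\<close>, together with
  \<open>EL\<close>, have the finite intersection property by \<open>S_ext_approx\<close>. A common
  point only gives that \<open>p\<close> is included in the value at tp(c); two complete types so
  related are equal.\<close>

lemma EL_attains: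
  assumes c: "range c \<subseteq> univ M" and p: "p \<in> S_ext L M c"
  obtains \<eta> where "\<eta> \<in> EL L M c" "\<eta> (tp L M (univ M) UNIV c) = p"
proof -
  define t where "t = tp L M (univ M) UNIV c"
  have t: "t \<in> S_ext L M c" unfolding t_def by (rule tp_in_S_ext[OF c refl])
  define K where "K \<phi> = {\<eta> \<in> topspace (S_ext_maps L M c). \<phi> \<in> \<eta> t}" for \<phi>
  have "compact_space (S_ext_maps L M c)"
    using compact_space_S_ext_topology by (auto simp: compact_space_product_topology)
  moreover have "closedin (S_ext_maps L M c) C" if C: "C \<in> insert (EL L M c) (K ` p)" for C
  proof -
    have "closedin (S_ext_maps L M c) (K \<phi>)" if "\<phi> \<in> p" for \<phi>
      unfolding K_def
      using S_ext_maps_clopen(1)[OF t] type_space_fmlas[OF S_ext_type_space[OF p] that] .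
    then show ?thesis using C by (auto simp: EL_eq)
  qed
  moreover have "\<Inter>\<F> \<noteq> {}" if \<F>: "finite \<F>" "\<F> \<subseteq> insert (EL L M c) (K ` p)" for \<F>
  proof -
    obtain p\<^sub>0 where p0: "p\<^sub>0 \<subseteq> p" "finite p\<^sub>0" "\<F> - {EL L M c} = K ` p\<^sub>0"
      using finite_subset_image[of "\<F> - {EL L M c}" K p] \<F> by blast
    have "p\<^sub>0 \<subseteq> fmlas L (UNIV <+> univ M)"
      using p0(1) type_space_fmlas[OF S_ext_type_space[OF p]] by blast
    then obtain g where g: "g \<in> Aut L M"
      "\<And>\<phi>. \<phi> \<in> p\<^sub>0 \<Longrightarrow> \<phi> \<in> p \<longleftrightarrow> holds M (case_sum (g \<circ> c) id) \<phi>"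
      using S_ext_approx[OF c p p0(2)] by metis
    define \<eta> where "\<eta> = restrict (act g) (S_ext L M c)"
    have top: "\<eta> \<in> topspace (S_ext_maps L M c)"
      using orbit_subset_topspace g(1) unfolding \<eta>_def by blast
    have "\<eta> \<in> EL L M c"
      unfolding EL_eq \<eta>_def using closure_of_subset[OF orbit_subset_topspace] g(1) by blast
    moreover have "\<eta> \<in> K \<phi>" if "\<phi> \<in> p\<^sub>0" for \<phi>
    proof -
      have "\<eta> t = tp L M (univ M) UNIV (g \<circ> c)"
        using t act_tp[OF struct g(1), of c UNIV] c by (simp add: \<eta>_def t_def)
      moreover have "\<phi> \<in> tp L M (univ M) UNIV (g \<circ> c)"
        using g(2)[OF that] that p0(1) \<open>p\<^sub>0 \<subseteq> fmlas L (UNIV <+> univ M)\<close> unfolding tp_def by blast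
      ultimately show ?thesis using top by (simp add: K_def)
    qed
    ultimately have "\<eta> \<in> \<Inter>\<F>" using p0(3) by blast
    then show ?thesis by blast
  qed
  ultimately have "\<Inter> (insert (EL L M c) (K ` p)) \<noteq> {}"
    unfolding compact_space_fip by blast
  then obtain \<eta> where \<eta>: "\<eta> \<in> EL L M c" "\<And>\<phi>. \<phi> \<in> p \<Longrightarrow> \<eta> \<in> K \<phi>" by blast
  have "p \<subseteq> \<eta> t" using \<eta>(2) by (auto simp: K_def)
  then have "p = \<eta> t"
    using type_space_subset_eq[OF S_ext_type_space[OF p] S_ext_type_space[OF EL_maps_S_ext[OF \<eta>(1) t]]]
    by blast
  then show ?thesis using that \<eta>(1) by (simp add: t_def)
qed

text \<open>For an automorphism \<open>g\<close> both sides say that \<phi> holds of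
  \<open>g \<circ> c \<circ> s\<close>. The set \<open>W\<close> of maps on which the two conditions
  agree is closed, so it contains the closure of the automorphisms.\<close>

lemma EL_reindex:
  assumes c: "range c \<subseteq> univ M" and \<eta>: "\<eta> \<in> EL L M c"
    and cs: "tp L M {} UNIV (c \<circ> s) = tp L M {} UNIV c"
    and \<phi>: "\<phi> \<in> fmlas L (UNIV <+> univ M)"
  shows "\<phi> \<in> \<eta> (tp L M (univ M) UNIV (c \<circ> s)) \<longleftrightarrow>
    rename (map_sum s id) \<phi> \<in> \<eta> (tp L M (univ M) UNIV c)"
proof -
  define t where "t = tp L M (univ M) UNIV c"
  define t' where "t' = tp L M (univ M) UNIV (c \<circ> s)"
  define \<psi> where "\<psi> = rename (map_sum s id) \<phi>"
  have csr: "range (c \<circ> s) \<subseteq> univ M" using c by auto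
  have t: "t \<in> S_ext L M c" "t' \<in> S_ext L M c"
    unfolding t_def t'_def using tp_in_S_ext[OF c refl] tp_in_S_ext[OF csr cs] by auto
  have \<psi>: "\<psi> \<in> fmlas L (UNIV <+> univ M)"
    unfolding \<psi>_def using \<phi> by (rule fmlas_rename) auto
  define K where "K = {\<eta> \<in> topspace (S_ext_maps L M c). \<phi> \<in> \<eta> t'}"
  define K' where "K' = {\<eta> \<in> topspace (S_ext_maps L M c). \<psi> \<in> \<eta> t}"
  define W where "W = (K \<inter> K') \<union> (topspace (S_ext_maps L M c) - (K \<union> K'))"
  have "closedin (S_ext_maps L M c) W"
    unfolding W_def K_def K'_def
    using S_ext_maps_clopen[OF t(2) \<phi>] S_ext_maps_clopen[OF t(1) \<psi>]
    by (intro closedin_Un closedin_Int closedin_diff openin_Un closedin_topspace)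
  moreover have "restrict (act g) (S_ext L M c) \<in> W" if g: "g \<in> Aut L M" for g
  proof -
    have "act g t' = tp L M (univ M) UNIV (g \<circ> c \<circ> s)"
      unfolding t'_def using act_tp[OF struct g, of "c \<circ> s" UNIV] csr by (simp add: comp_assoc)
    moreover have "act g t = tp L M (univ M) UNIV (g \<circ> c)"
      unfolding t_def using act_tp[OF struct g, of c UNIV] c by simp
    moreover have "\<phi> \<in> tp L M (univ M) UNIV (g \<circ> c \<circ> s) \<longleftrightarrow> \<psi> \<in> tp L M (univ M) UNIV (g \<circ> c)"
      using \<phi> \<psi> by (simp add: tp_def \<psi>_def holds_rename_map_sum del: o_apply)
    moreover have "restrict (act g) (S_ext L M c) \<in> topspace (S_ext_maps L M c)"
      using orbit_subset_topspace g by blast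
    ultimately show ?thesis using t by (simp add: W_def K_def K'_def)
  qed
  ultimately have "EL L M c \<subseteq> W"
    unfolding EL_eq by (intro closure_of_minimal) auto
  then have "\<eta> \<in> W" using \<eta> by blast
  then show ?thesis by (auto simp: W_def K_def K'_def t_def t'_def \<psi>_def)
qed

text \<open>
  Every realized type is \<open>tp(c \<circ> s)\<close> for some reindexing \<open>s\<close>, as \<open>c\<close> enumerates the whole model,
  and the value of \<open>\<eta>\<close> there is the reindexing of its value at \<open>tp(c)\<close>. So \<open>\<eta>\<close> maps all realized
  types into \<open>X\<close> as soon as it maps the single type \<open>tp(c)\<close> into \<open>X\<close>.
\<close>

lemma EL_realized_types_into_iff:
  fixes c :: "'i \<Rightarrow> 'm"
  assumes c: "range c = univ M" and X: "X \<subseteq> S_ext L M c"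
    and reindex: "\<And>p p' s. \<lbrakk>p \<in> X; p' \<in> S_ext L M c;
      \<And>\<phi>. \<phi> \<in> fmlas L (UNIV <+> univ M) \<Longrightarrow> \<phi> \<in> p' \<longleftrightarrow> rename (map_sum s id) \<phi> \<in> p\<rbrakk> \<Longrightarrow> p' \<in> X"
  shows "(\<exists>\<eta> \<in> EL L M c. \<forall>p \<in> realized_types L M c. \<eta> p \<in> X) \<longleftrightarrow> X \<noteq> {}"
proof
  assume "\<exists>\<eta> \<in> EL L M c. \<forall>p \<in> realized_types L M c. \<eta> p \<in> X"
  moreover have "tp L M (univ M) UNIV c \<in> realized_types L M c"
    using c by (auto simp: realized_types_def)
  ultimately show "X \<noteq> {}" by blast
next
  assume "X \<noteq> {}"
  then obtain p where p: "p \<in> X" by blast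
  have c': "range c \<subseteq> univ M" using c by simp
  obtain \<eta> where \<eta>: "\<eta> \<in> EL L M c" "\<eta> (tp L M (univ M) UNIV c) = p"
    using EL_attains[OF c'] p X by blast
  have "\<eta> t \<in> X" if t: "t \<in> realized_types L M c" for t
  proof -
    obtain d where d: "t = tp L M (univ M) UNIV d" "range d \<subseteq> univ M"
      "tp L M {} UNIV d = tp L M {} UNIV c"
      using t by (auto simp: realized_types_def)
    define s where "s i = inv_into UNIV c (d i)" for i
    have "d = c \<circ> s"
      using d(2) c by (auto simp: s_def fun_eq_iff subset_iff intro!: f_inv_into_f[symmetric])
    then show ?thesis
      using reindex[OF p EL_maps_S_ext[OF \<eta>(1) tp_in_S_ext[OF d(2,3)]], of s]
        EL_reindex[OF c' \<eta>(1), of s] d(1,3) \<eta>(2) by simp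
  qed
  then show "\<exists>\<eta> \<in> EL L M c. \<forall>p \<in> realized_types L M c. \<eta> p \<in> X" using \<eta>(1) by blast
qed

text \<open>Plugging in \<open>a\<close> concerns x and reindexing concerns y. Hence the instances
  of \<phi> in \<open>p'\<close> correspond to instances of one other formula \<psi> in
  \<open>p\<close>, with the same realizations of \<open>q\<close>.\<close>

lemma EL_realized_types_into_Inv_q_iff:
  assumes "range c = univ M"
  shows "(\<exists>\<eta> \<in> EL L M c. \<forall>p \<in> realized_types L M c. \<eta> p \<in> Inv_q L M n q c) \<longleftrightarrow>
    Inv_q L M n q c \<noteq> {}"
proof (rule EL_realized_types_into_iff[OF assms])
  show "Inv_q L M n q c \<subseteq> S_ext L M c" by (auto simp: Inv_q_def)
  fix p p' s assume p: "p \<in> Inv_q L M n q c" and p': "p' \<in> S_ext L M c"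
    and iff: "\<And>\<phi>. \<phi> \<in> fmlas L (UNIV <+> univ M) \<Longrightarrow> \<phi> \<in> p' \<longleftrightarrow> rename (map_sum s id) \<phi> \<in> p"
  have "plug a \<phi> \<in> p' \<longleftrightarrow> plug a' \<phi> \<in> p'"
    if \<phi>: "\<phi> \<in> fmlas L ({..<n} <+> UNIV)" and a: "a \<in> realizations L M {} n q"
      "a' \<in> realizations L M {} n q" for \<phi> a a'
  proof -
    define \<psi> where "\<psi> = rename (map_sum id s) \<phi>"
    have \<psi>: "\<psi> \<in> fmlas L ({..<n} <+> UNIV)"
      unfolding \<psi>_def using \<phi> by (rule fmlas_rename) auto
    have eq: "plug b \<phi> \<in> p' \<longleftrightarrow> plug b \<psi> \<in> p" if b: "b \<in> realizations L M {} n q" for b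
    proof -
      have "plug b \<phi> \<in> fmlas L (UNIV <+> univ M)"
        by (rule plug_in_fmlas) (use \<phi> b in \<open>auto simp: realizations_def\<close>)
      moreover have "rename (map_sum s id) (plug b \<phi>) = plug b \<psi>"
        unfolding plug_def \<psi>_def rename_rename by (rule rename_cong) (auto split: sum.split)
      ultimately show ?thesis using iff by metis
    qed
    show ?thesis using p \<psi> a eq unfolding Inv_q_def by blast
  qed
  then show "p' \<in> Inv_q L M n q c" using p' unfolding Inv_q_def by blast
qed

lemma EL_realized_types_into_Inv_iff:
  assumes "range c = univ M"
  shows "(\<exists>\<eta> \<in> EL L M c. \<forall>p \<in> realized_types L M c. \<eta> p \<in> Inv L M c) \<longleftrightarrow> Inv L M c \<noteq> {}"
proof (rule EL_realized_types_into_iff[OF assms])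
  show "Inv L M c \<subseteq> S_ext L M c" by (auto simp: Inv_def)
  fix p p' s assume "p \<in> Inv L M c" and p': "p' \<in> S_ext L M c"
    and iff: "\<And>\<phi>. \<phi> \<in> fmlas L (UNIV <+> univ M) \<Longrightarrow> \<phi> \<in> p' \<longleftrightarrow> rename (map_sum s id) \<phi> \<in> p"
  then have p: "p \<in> S_ext L M c" and inv: "\<And>g. g \<in> Aut L M \<Longrightarrow> act g p = p"
    by (auto simp: Inv_def)
  have "act g p' = p'" if g: "g \<in> Aut L M" for g
    unfolding act_eq_iff[OF struct g S_ext_type_space[OF p']]
  proof
    fix \<phi> :: "('f, 'r, 'a + 'm) fm" assume \<phi>: "\<phi> \<in> fmlas L (UNIV <+> univ M)"
    have "rename (map_sum s id) \<phi> \<in> fmlas L (UNIV <+> univ M)"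
      using \<phi> by (rule fmlas_rename) auto
    then have "rename (map_sum s id) \<phi> \<in> p \<longleftrightarrow> rename (map_sum id g) (rename (map_sum s id) \<phi>) \<in> p"
      using act_eq_iff[OF struct g S_ext_type_space[OF p]] inv[OF g] by blast
    then show "\<phi> \<in> p' \<longleftrightarrow> rename (map_sum id g) \<phi> \<in> p'"
      unfolding iff[OF \<phi>] iff[OF rename_Aut_in_fmlas[OF \<phi> g]] rename_commute .
  qed
  then show "p' \<in> Inv L M c" using p' by (simp add: Inv_def)
qed

lemma type_DEERP_iff_Inv_q_nonempty:
  assumes "range c = univ M" "q \<in> type_space L M {} {..<n}"
  shows "type_DEERP L M n q \<longleftrightarrow> Inv_q L M n q c \<noteq> {}"
  using Inv_q_nonempty_if_type_DEERP type_DEERP_if_Inv_q_nonempty assms by (metis order_refl)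

lemma theory_DEERP_iff_Inv_nonempty:
  assumes "range c = univ M"
  shows "theory_DEERP L M \<longleftrightarrow> Inv L M c \<noteq> {}"
proof
  assume "theory_DEERP L M"
  then show "Inv L M c \<noteq> {}"
    using type_DEERP_iff_Inv_q_nonempty[OF assms]
    by (intro Inv_nonempty_if_Inv_q_nonempty) (auto simp: theory_DEERP_def)
next
  assume "Inv L M c \<noteq> {}"
  then have "Inv_q L M n q c \<noteq> {}" for n q using Inv_subset_Inv_q by blast
  then show "theory_DEERP L M"
    using type_DEERP_iff_Inv_q_nonempty[OF assms] by (simp add: theory_DEERP_def)
qed

end

section \<open>Monster models as instances\<close>

lemma monster_model_imp_homogeneous_struct:
  fixes L :: "('f, 'r) language" and M :: "('f, 'r, 'm) struct"
  assumes "monster_model \<kappa> L T M"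
  shows "homogeneous_struct L M"
proof -
  \<comment> \<open>The equations between a variable and itself exist in every language and are
    infinitely many. So \<kappa> lies above an infinite set, and finite parameter sets count as
    small.\<close>
  have "inj (\<lambda>n :: nat. Eq (Var n) (Var n) :: ('f, 'r, nat) fm)" by (auto intro: injI)
  then have "infinite (range (\<lambda>n :: nat. Eq (Var n) (Var n) :: ('f, 'r, nat) fm))"
    by (rule range_inj_infinite)
  moreover have "range (\<lambda>n :: nat. Eq (Var n) (Var n)) \<subseteq> (fmlas L UNIV :: ('f, 'r, nat) fm set)"
    by (auto simp: fmlas_def)
  ultimately have inf: "infinite (fmlas L UNIV :: ('f, 'r, nat) fm set)"
    using infinite_super by blast
  have small: "|A| <o \<kappa>" if "finite A" for A :: "'m set"
  proof (rule ordLess_transitive)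
    show "|A| <o |fmlas L UNIV :: ('f, 'r, nat) fm set|"
      using that inf by (intro finite_ordLess_infinite[OF card_of_Well_order card_of_Well_order])
        (auto simp: Field_card_of)
    show "|fmlas L UNIV :: ('f, 'r, nat) fm set| <o \<kappa>"
      using assms by (simp add: monster_model_def)
  qed
  show ?thesis
  proof
    show "is_struct L M" using assms by (simp add: monster_model_def is_model_def)
    show "realizations L M A n p \<noteq> {}"
      if "A \<subseteq> univ M" "finite A" "p \<in> type_space L M A {..<n}" for A n p
      using assms small that unfolding monster_model_def saturated_def by blast
    show "\<exists>g \<in> Aut L M. \<forall>x\<in>A. g x = h x"
      if "A \<subseteq> univ M" "finite A" "elementary_map L M A h" for A h
      using assms small that unfolding monster_model_def strongly_homogeneous_def by blast
  qed
qed

theorem theorem3p16: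
  fixes L :: "('f, 'r) language" and T :: "('f, 'r, nat) fm set"
    and M :: "('f, 'r, 'm) struct" and \<kappa> :: "'k rel" and c :: "'i \<Rightarrow> 'm"
  assumes "complete_theory L T"
    and "monster_model \<kappa> L T M"
    and "range c = univ M"
    and "infinite (UNIV :: 'v set)"
  shows "(\<forall>n. \<forall>q \<in> type_space L M {} {..<n}.
            (type_DEERP L M n q \<longleftrightarrow>
               (\<exists>\<eta> \<in> EL L M c. \<forall>p \<in> realized_types L M c. \<eta> p \<in> Inv_q L M n q c)) \<and>
            ((\<exists>\<eta> \<in> EL L M c. \<forall>p \<in> realized_types L M c. \<eta> p \<in> Inv_q L M n q c) \<longleftrightarrow>
               Inv_q L M n q c \<noteq> {})) \<and>
         ((theory_DEERP L M \<longleftrightarrow>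
               (\<exists>\<eta> \<in> EL L M c. \<forall>p \<in> realized_types L M c. \<eta> p \<in> Inv L M c)) \<and>
          ((\<exists>\<eta> \<in> EL L M c. \<forall>p \<in> realized_types L M c. \<eta> p \<in> Inv L M c) \<longleftrightarrow>
               extremely_amenable TYPE('v) L M) \<and>
          (extremely_amenable TYPE('v) L M \<longleftrightarrow> Inv L M c \<noteq> {}))"
proof -
  interpret homogeneous_struct L M
    using assms(2) by (rule monster_model_imp_homogeneous_struct)
  have "extremely_amenable TYPE('v) L M \<longleftrightarrow> Inv L M c \<noteq> {}"
    using extremely_amenable_if_Inv_nonempty[OF assms(3)]
      Inv_nonempty_if_extremely_amenable[of c, where 'v = 'v] assms(3,4) by blast
  then show ?thesis
    unfolding EL_realized_types_into_Inv_q_iff[OF assms(3)] EL_realized_types_into_Inv_iff[OF assms(3)]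
    using type_DEERP_iff_Inv_q_nonempty[OF assms(3)] theory_DEERP_iff_Inv_nonempty[OF assms(3)]
    by blast
qed

end
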